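(* Let $n\ge 1$, let $\alpha,\beta>0$ and $q_0,q_1\in[1,+\infty]$ with $q_0<q_1$. Let $\theta=\frac{\alpha}{\alpha+\beta}\in(0,1)$ and let $p$ be defined by $\frac1p=\frac{1-\theta}{q_0}+\frac{\theta}{q_1}$. Let $q_0\le r_0\le r_1\le q_1$ and let $r$ be defined by $\frac1r=\frac{1-\theta}{r_0}+\frac{\theta}{r_1}$. Then there is a constant $C_0$ such that every $f\in\dot B^{\alpha,q_0}_{r_0}\cap\dot B^{-\beta,q_1}_{r_1}(\mathbb{R}^n)$ belongs to $L^{p,r}(\mathbb{R}^n)$ and satisfies $$\|f\|_{L^{p,r}}\le C_0\,\|f\|_{\dot B^{\alpha,q_0}_{r_0}}^{1-\theta}\,\|f\|_{\dot B^{-\beta,q_1}_{r_1}}^{\theta}.$$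
   Context: Littlewood–Paley decomposition: fix a nonnegative $\varphi\in C_c^\infty(\mathbb{R}^n)$ with $\varphi(\xi)=1$ for $|\xi|\le 1/2$ and $\varphi(\xi)=0$ for $|\xi|\ge 1$, and put $\psi(\xi)=\varphi(\xi/2)-\varphi(\xi)$. For $f\in\mathcal{S}'(\mathbb{R}^n)$ and $j\in\mathbb{Z}$, the dyadic block $\Delta_jf$ is defined by $\widehat{\Delta_jf}(\xi)=\psi(2^{-j}\xi)\widehat f(\xi)$. For $s\in\mathbb{R}$ and $q,r\in[1,+\infty]$, the semi-norm of the homogeneous Besov space $\dot B^{s,q}_r(\mathbb{R}^n)$ (first upper index: regularity; second upper index: Lebesgue exponent; lower index: summation exponent) is $\|f\|_{\dot B^{s,q}_r}=\big(\sum_{j\in\mathbb{Z}}2^{jsr}\|\Delta_jf\|_{L^q}^r\big)^{1/r}$, with the supremum over $j$ when $r=+\infty$. Convention: for $\alpha,\beta>0$, $f\in\dot B^{\alpha,q_0}_{r_0}\cap\dot B^{-\beta,q_1}_{r_1}$ means that $f\in\mathcal{S}'(\mathbb{R}^n)$ satisfies $f=\sum_{j\in\mathbb{Z}}\Delta_jf$ (convergence in $\mathcal{S}'$) and that both semi-norms are finite. Lorentz spaces: for $1<p<+\infty$, $1\le r\le+\infty$, $L^{p,r}(\mathbb{R}^n)$ is the set of measurable $f$ (modulo a.e. equality) with $\|f\|_{L^{p,r}}=\big(\int_0^{+\infty}(s^{1/p}f^*(s))^r\frac{ds}{s}\big)^{1/r}<+\infty$ (and $\sup_{s>0}s^{1/p}f^*(s)$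 when $r=+\infty$), where $d_f(t)$ is the Lebesgue measure of $\{x:|f(x)|\ge t\}$ and $f^*(s)=\inf\{t:d_f(t)\le s\}$; equivalently, up to equivalence of norms, $L^{p,r}$ is the real interpolation space $[L^1,L^\infty]_{1-1/p,r}$. Note that $q_0<q_1$ forces $1<p<+\infty$. *)

theory Defs
  imports "HOL-Analysis.Analysis" "HOL-Probability.Essential_Supremum"
begin

section \<open>Smooth functions, Schwartz functions and tempered distributions\<close>

text \<open>Partial derivatives are indexed by lists of standard basis vectors instead of multi-indices:
  a list of length \<open>k\<close> stands for the derivative of order \<open>k\<close> in the listed directions,
  with repetitions allowed.\<close>

fun iter_partial :: "'a::euclidean_space list \<Rightarrow> ('a \<Rightarrow> 'b::real_normed_vector) \<Rightarrow> 'a \<Rightarrow> 'b" where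
  "iter_partial [] f = f"
| "iter_partial (b # bs) f = (\<lambda>x. frechet_derivative (iter_partial bs f) (at x) b)"

definition smooth :: "('a::euclidean_space \<Rightarrow> 'b::real_normed_vector) \<Rightarrow> bool" where
  "smooth f \<longleftrightarrow> (\<forall>bs x. set bs \<subseteq> Basis \<longrightarrow> iter_partial bs f differentiable (at x))"

definition schwartz :: "('a::euclidean_space \<Rightarrow> complex) \<Rightarrow> bool" where
  "schwartz \<eta> \<longleftrightarrow> smooth \<eta> \<and>
     (\<forall>k::nat. \<forall>bs. set bs \<subseteq> Basis \<longrightarrow>
        bdd_above (range (\<lambda>x. (1 + norm x) ^ k * norm (iter_partial bs \<eta> x))))"

definition schwartz_seminorm :: "nat \<Rightarrow> ('a::euclidean_space \<Rightarrow> complex) \<Rightarrow> real" where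
  "schwartz_seminorm N \<eta> =
     (\<Sum>bs | set bs \<subseteq> Basis \<and> length bs \<le> N. SUP x. (1 + norm x) ^ N * norm (iter_partial bs \<eta> x))"

text \<open>A tempered distribution is a functional whose values matter on Schwartz functions only; there
  it is linear and continuous for the topology defined by the Schwartz seminorms. Its values
  elsewhere are unconstrained and never used.\<close>

definition tempered_distribution :: "(('a::euclidean_space \<Rightarrow> complex) \<Rightarrow> complex) \<Rightarrow> bool" where
  "tempered_distribution u \<longleftrightarrow>
     (\<forall>\<eta> \<zeta>. schwartz \<eta> \<longrightarrow> schwartz \<zeta> \<longrightarrow> u (\<lambda>x. \<eta> x + \<zeta> x) = u \<eta> + u \<zeta>) \<and>
     (\<forall>c \<eta>. schwartz \<eta> \<longrightarrow> u (\<lambda>x. c * \<eta> x) = c * u \<eta>) \<and>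
     (\<exists>N C. \<forall>\<eta>. schwartz \<eta> \<longrightarrow> norm (u \<eta>) \<le> C * schwartz_seminorm N \<eta>)"

text \<open>The distribution \<open>u\<close> is (given by) the function \<open>g\<close>.\<close>

definition represents :: "('a::euclidean_space \<Rightarrow> complex) \<Rightarrow> (('a \<Rightarrow> complex) \<Rightarrow> complex) \<Rightarrow> bool" where
  "represents g u \<longleftrightarrow> g \<in> borel_measurable lborel \<and>
     (\<forall>\<eta>. schwartz \<eta> \<longrightarrow>
        integrable lborel (\<lambda>x. g x * \<eta> x) \<and> u \<eta> = (LINT x|lborel. g x * \<eta> x))"


section \<open>Fourier transform\<close>

definition fourier :: "('a::euclidean_space \<Rightarrow> complex) \<Rightarrow> 'a \<Rightarrow> complex" where
  "fourier \<eta> \<xi> = (LINT x|lborel. cis (- (x \<bullet> \<xi>)) * \<eta> x)"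

definition inv_fourier :: "('a::euclidean_space \<Rightarrow> complex) \<Rightarrow> 'a \<Rightarrow> complex" where
  "inv_fourier \<eta> x = (LINT \<xi>|lborel. cis (x \<bullet> \<xi>) * \<eta> \<xi>) / (2 * pi) ^ DIM('a)"

text \<open>On distributions these operations, and multiplication by a smooth function, act by duality.\<close>

definition fourier_dist ::
    "(('a::euclidean_space \<Rightarrow> complex) \<Rightarrow> complex) \<Rightarrow> ('a \<Rightarrow> complex) \<Rightarrow> complex" where
  "fourier_dist u = (\<lambda>\<eta>. u (fourier \<eta>))"

definition inv_fourier_dist ::
    "(('a::euclidean_space \<Rightarrow> complex) \<Rightarrow> complex) \<Rightarrow> ('a \<Rightarrow> complex) \<Rightarrow> complex" where
  "inv_fourier_dist u = (\<lambda>\<eta>. u (inv_fourier \<eta>))"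

definition mult_dist ::
    "('a::euclidean_space \<Rightarrow> real) \<Rightarrow> (('a \<Rightarrow> complex) \<Rightarrow> complex) \<Rightarrow> ('a \<Rightarrow> complex) \<Rightarrow> complex" where
  "mult_dist m u = (\<lambda>\<eta>. u (\<lambda>\<xi>. complex_of_real (m \<xi>) * \<eta> \<xi>))"


section \<open>Littlewood--Paley decomposition\<close>

definition lp_cutoff :: "('a::euclidean_space \<Rightarrow> real) \<Rightarrow> bool" where
  "lp_cutoff \<phi> \<longleftrightarrow> smooth \<phi> \<and> compact (closure {\<xi>. \<phi> \<xi> \<noteq> 0}) \<and> (\<forall>\<xi>. \<phi> \<xi> \<ge> 0) \<and>
     (\<forall>\<xi>. norm \<xi> \<le> 1/2 \<longrightarrow> \<phi> \<xi> = 1) \<and> (\<forall>\<xi>. norm \<xi> \<ge> 1 \<longrightarrow> \<phi> \<xi> = 0)"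

definition lp_psi :: "('a::euclidean_space \<Rightarrow> real) \<Rightarrow> 'a \<Rightarrow> real" where
  "lp_psi \<phi> \<xi> = \<phi> (\<xi> /\<^sub>R 2) - \<phi> \<xi>"

definition dyadic_block :: "('a::euclidean_space \<Rightarrow> real) \<Rightarrow> int \<Rightarrow>
    (('a \<Rightarrow> complex) \<Rightarrow> complex) \<Rightarrow> ('a \<Rightarrow> complex) \<Rightarrow> complex" where
  "dyadic_block \<phi> j f =
     inv_fourier_dist (mult_dist (\<lambda>\<xi>. lp_psi \<phi> ((2 powi (- j)) *\<^sub>R \<xi>)) (fourier_dist f))"

text \<open>\<open>f = (\<Sum>j\<in>\<int>. \<Delta>\<^sub>j f)\<close> in the (weak) topology of tempered distributions. Both ends of the two-sided
  series tend to infinity independently.\<close>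

definition lp_sum_converges ::
    "('a::euclidean_space \<Rightarrow> real) \<Rightarrow> (('a \<Rightarrow> complex) \<Rightarrow> complex) \<Rightarrow> bool" where
  "lp_sum_converges \<phi> f \<longleftrightarrow>
     (\<forall>\<eta>. schwartz \<eta> \<longrightarrow>
        ((\<lambda>(M, N). \<Sum>j\<in>{- int M..int N}. dyadic_block \<phi> j f \<eta>) \<longlongrightarrow> f \<eta>)
          (sequentially \<times>\<^sub>F sequentially))"


section \<open>Lebesgue, Besov and Lorentz norms\<close>

text \<open>Powers of extended nonnegative reals, meant for positive exponents \<open>a\<close>.\<close>

definition epowr :: "ennreal \<Rightarrow> real \<Rightarrow> ennreal" (infixr "epowr" 80) where
  "x epowr a = (if x = \<infinity> then \<infinity> else ennreal (enn2real x powr a))"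

definition lebesgue_norm :: "ennreal \<Rightarrow> ('a::euclidean_space \<Rightarrow> complex) \<Rightarrow> ennreal" where
  "lebesgue_norm q g =
     (if q = \<infinity> then esssup lborel (\<lambda>x. ennreal (norm (g x)))
      else (\<integral>\<^sup>+x. ennreal (norm (g x)) epowr enn2real q \<partial>lborel) epowr (1 / enn2real q))"

text \<open>The infimum only serves to select the function representing the distribution, which is unique
  almost everywhere; it is \<open>\<infinity>\<close> if there is none.\<close>

definition lebesgue_norm_dist ::
    "ennreal \<Rightarrow> (('a::euclidean_space \<Rightarrow> complex) \<Rightarrow> complex) \<Rightarrow> ennreal" where
  "lebesgue_norm_dist q u = (INF g\<in>{g. represents g u}. lebesgue_norm q g)"

text \<open>Order of the arguments: regularity, Lebesgue exponent, summation exponent.\<close>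

definition besov_seminorm :: "('a::euclidean_space \<Rightarrow> real) \<Rightarrow> real \<Rightarrow> ennreal \<Rightarrow> ennreal \<Rightarrow>
    (('a \<Rightarrow> complex) \<Rightarrow> complex) \<Rightarrow> ennreal" where
  "besov_seminorm \<phi> s q r f =
     (if r = \<infinity>
      then (SUP j::int. ennreal (2 powr (real_of_int j * s)) * lebesgue_norm_dist q (dyadic_block \<phi> j f))
      else (\<Sum>\<^sub>\<infinity>j::int. ennreal (2 powr (real_of_int j * s * enn2real r)) *
              lebesgue_norm_dist q (dyadic_block \<phi> j f) epowr enn2real r) epowr (1 / enn2real r))"

definition distribution_fun :: "('a::euclidean_space \<Rightarrow> complex) \<Rightarrow> real \<Rightarrow> ennreal" where
  "distribution_fun g t = emeasure lborel {x. norm (g x) \<ge> t}"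

text \<open>Negative \<open>t\<close> can be left out of the infimum, since there the distribution function is infinite.\<close>

definition decr_rearrangement :: "('a::euclidean_space \<Rightarrow> complex) \<Rightarrow> real \<Rightarrow> ennreal" where
  "decr_rearrangement g s = (INF t\<in>{t. t \<ge> 0 \<and> distribution_fun g t \<le> ennreal s}. ennreal t)"

definition lorentz_norm :: "real \<Rightarrow> ennreal \<Rightarrow> ('a::euclidean_space \<Rightarrow> complex) \<Rightarrow> ennreal" where
  "lorentz_norm p r g =
     (if r = \<infinity>
      then (SUP s\<in>{0<..}. ennreal (s powr (1 / p)) * decr_rearrangement g s)
      else (\<integral>\<^sup>+s\<in>{0<..}. (ennreal (s powr (1 / p)) * decr_rearrangement g s) epowr enn2real r
              * ennreal (1 / s) \<partial>lborel) epowr (1 / enn2real r))"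

definition lorentz_space :: "real \<Rightarrow> ennreal \<Rightarrow> ('a::euclidean_space \<Rightarrow> complex) set" where
  "lorentz_space p r = {g \<in> borel_measurable lborel. lorentz_norm p r g < \<infinity>}"

end

theory Submission
  imports Defs
begin

text \<open>
  No Fourier analysis is needed beyond the definition of the blocks \<open>u\<^sub>j = \<Delta>\<^sub>j f\<close>: the estimate is the real
  interpolation of \<open>L\<^sup>q\<close> for \<open>q = q\<^sub>0\<close> and \<open>q = q\<^sub>1\<close> by the method of means of Lions and Peetre. Put
  \<open>a\<^sub>j = 2 powr (\<alpha> * j) * \<parallel>u\<^sub>j\<parallel>\<^sub>q\<^sub>0\<close> and \<open>b\<^sub>j = 2 powr (- \<beta> * j) * \<parallel>u\<^sub>j\<parallel>\<^sub>q\<^sub>1\<close>. The mean of \<open>\<bar>u\<bar>\<close> over a set of measure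
  \<open>m\<close> is at most \<open>2 * m powr (- 1 / q) * \<parallel>u\<parallel>\<^sub>q\<close>. Applied to a set on which \<open>\<bar>\<Sum>u\<^sub>j\<bar>\<close> is large, with
  \<open>q = q\<^sub>0\<close> for \<open>j \<ge> J\<close> and \<open>q = q\<^sub>1\<close> for \<open>j < J\<close>, it bounds the decreasing rearrangement at \<open>s\<close> by
  \<open>K * (s powr (- 1 / q\<^sub>0) * F J + s powr (- 1 / q\<^sub>1) * G J)\<close> for every \<open>J\<close>. Here \<open>F J\<close> controls the sum of
  \<open>2 powr (- \<alpha> * j) * a\<^sub>j\<close> over \<open>j \<ge> J\<close>, and \<open>G J\<close> that of \<open>2 powr (\<beta> * j) * b\<^sub>j\<close> over \<open>j \<le> J\<close>. Taking \<open>J\<close> where the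
  larger of the two terms changes, this becomes \<open>2 * K\<close> times the minimum of \<open>s powr (- 1 / q\<^sub>0) * F J\<close> and
  \<open>s powr (- 1 / q\<^sub>1) * G (J + 1)\<close>. The \<open>r\<close>-th power of the minimum, weighted as in the Lorentz norm, integrates
  to a multiple of \<open>(F J powr (1 - \<theta>) * G (J + 1) powr \<theta>) powr r\<close>, and these are summed over \<open>J\<close> by Young's inequality.
\<close>

section \<open>Uniqueness of the function representing a distribution\<close>

lemma lp_cutoff_differentiable:
  assumes "lp_cutoff \<phi>" and "set bs \<subseteq> Basis"
  shows "iter_partial bs \<phi> differentiable (at x)"
  using assms by (auto simp: lp_cutoff_def smooth_def)

lemma lp_cutoff_continuous:
  assumes "lp_cutoff \<phi>" and "set bs \<subseteq> Basis"
  shows "continuous_on S (iter_partial bs \<phi>)"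
  using lp_cutoff_differentiable[OF assms] differentiable_imp_continuous_within continuous_at_imp_continuous_on by blast

text \<open>The strict inequality describes an open set, and a function vanishing on an open set has
  vanishing derivatives there.\<close>

lemma lp_cutoff_partial_eq_0:
  fixes \<phi> :: "'a::euclidean_space \<Rightarrow> real"
  assumes "lp_cutoff \<phi>" and "norm x > 1"
  shows "iter_partial bs \<phi> x = 0"
  using assms(2)
proof (induction bs arbitrary: x)
  case Nil
  then show ?case using assms(1) by (auto simp: lp_cutoff_def)
next
  case (Cons b bs)
  have "open {x::'a. norm x > 1}" by (intro open_Collect_less continuous_intros)
  then have "(iter_partial bs \<phi> has_derivative (\<lambda>_. 0)) (at x)"
    by (rule has_derivative_transform_within_open[OF has_derivative_const[of 0]])
       (use Cons in auto)
  then show ?case by (simp add: frechet_derivative_at[symmetric])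
qed

text \<open>Chain rule: every derivative brings out one factor \<open>c\<close>. Smoothness and
  decay of the rescaled cutoff are both read off from this formula.\<close>

lemma iter_partial_rescale:
  fixes \<phi> :: "'a::euclidean_space \<Rightarrow> real"
  assumes "lp_cutoff \<phi>" and "set bs \<subseteq> Basis"
  shows "iter_partial bs (\<lambda>x. complex_of_real (\<phi> (c *\<^sub>R (x - y)))) =
         (\<lambda>x. complex_of_real (c ^ length bs * iter_partial bs \<phi> (c *\<^sub>R (x - y))))"
  using assms(2)
proof (induction bs)
  case (Cons b bs)
  define P where "P = iter_partial bs \<phi>"
  have IH: "iter_partial bs (\<lambda>x. complex_of_real (\<phi> (c *\<^sub>R (x - y)))) =
         (\<lambda>x. complex_of_real (c ^ length bs * P (c *\<^sub>R (x - y))))"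
    using Cons by (simp add: P_def)
  have "P differentiable (at z)" for z
    using lp_cutoff_differentiable[OF assms(1)] Cons.prems by (auto simp: P_def)
  then have P: "(P has_derivative frechet_derivative P (at z)) (at z)" for z
    using frechet_derivative_works by blast
  have "((\<lambda>x. complex_of_real (c ^ length bs * P (c *\<^sub>R (x - y)))) has_derivative
      (\<lambda>h. complex_of_real (c ^ length bs * frechet_derivative P (at (c *\<^sub>R (x - y))) (c *\<^sub>R h)))) (at x)" for x
    by (auto intro!: derivative_eq_intros has_derivative_compose[OF _ P, of "\<lambda>x. c *\<^sub>R (x - y)"])
  then have "frechet_derivative (iter_partial bs (\<lambda>x. complex_of_real (\<phi> (c *\<^sub>R (x - y))))) (at x) b =
     complex_of_real (c ^ length bs * frechet_derivative P (at (c *\<^sub>R (x - y))) (c *\<^sub>R b))" for x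
    unfolding IH by (subst frechet_derivative_at[symmetric]) auto
  moreover have "frechet_derivative P (at z) (c *\<^sub>R b) = c * frechet_derivative P (at z) b" for z
    using linear_frechet_derivative[of P "at z"] P differentiableI by (metis linear_cmul real_scaleR_def)
  ultimately show ?case by (simp add: P_def fun_eq_iff algebra_simps)
qed simp

text \<open>Source of test functions for the uniqueness argument. The derivatives are continuous and
  vanish outside \<open>cball y (1/c)\<close>, so compactness bounds them against every polynomial
  weight.\<close>

lemma lp_cutoff_rescaled_schwartz:
  fixes \<phi> :: "'a::euclidean_space \<Rightarrow> real"
  assumes "lp_cutoff \<phi>" and "c > 0"
  shows "schwartz (\<lambda>x. complex_of_real (\<phi> (c *\<^sub>R (x - y))))"
proof -
  have "smooth (\<lambda>x. complex_of_real (\<phi> (c *\<^sub>R (x - y))))"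
    unfolding smooth_def
  proof (intro allI impI)
    fix bs x assume bs: "set bs \<subseteq> (Basis :: 'a set)"
    have "(\<lambda>x. iter_partial bs \<phi> (c *\<^sub>R (x - y))) differentiable at x"
      by (rule differentiable_compose[of "iter_partial bs \<phi>", OF lp_cutoff_differentiable[OF assms(1) bs]])
         (intro derivative_intros)
    then obtain D where "((\<lambda>x. iter_partial bs \<phi> (c *\<^sub>R (x - y))) has_derivative D) (at x)"
      unfolding differentiable_def by blast
    then have "((\<lambda>x. complex_of_real (c ^ length bs * iter_partial bs \<phi> (c *\<^sub>R (x - y)))) has_derivative
        (\<lambda>h. complex_of_real (c ^ length bs * D h))) (at x)"
      by (rule has_derivative_of_real[OF has_derivative_mult_right])
    then have "(\<lambda>x. complex_of_real (c ^ length bs * iter_partial bs \<phi> (c *\<^sub>R (x - y)))) differentiable at x"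
      unfolding differentiable_def by blast
    then show "iter_partial bs (\<lambda>x. complex_of_real (\<phi> (c *\<^sub>R (x - y)))) differentiable at x"
      unfolding iter_partial_rescale[OF assms(1) bs] .
  qed
  moreover have "bdd_above (range (\<lambda>x. (1 + norm x) ^ k *
      norm (iter_partial bs (\<lambda>x. complex_of_real (\<phi> (c *\<^sub>R (x - y)))) x)))" if bs: "set bs \<subseteq> Basis" for k bs
  proof -
    define g where "g = (\<lambda>x. (1 + norm x) ^ k * norm (complex_of_real (c ^ length bs * iter_partial bs \<phi> (c *\<^sub>R (x - y)))))"
    have "continuous_on (cball y (1/c)) g"
    proof -
      have "continuous_on (cball y (1/c)) (\<lambda>x. iter_partial bs \<phi> (c *\<^sub>R (x - y)))"
        by (rule continuous_on_compose2[OF lp_cutoff_continuous[OF assms(1) bs, of UNIV]])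
           (intro continuous_intros, simp)
      then show ?thesis unfolding g_def by (intro continuous_intros)
    qed
    then have "compact (g ` cball y (1/c))" by (intro compact_continuous_image) auto
    then have "bdd_above (g ` cball y (1/c))"
      by (intro bounded_imp_bdd_above compact_imp_bounded)
    then obtain B where B: "\<And>x. x \<in> cball y (1/c) \<Longrightarrow> g x \<le> B"
      unfolding bdd_above_def by (metis imageI)
    have "g x \<le> max B 0" for x
    proof (cases "x \<in> cball y (1/c)")
      case False
      then have "1 / c < norm (x - y)" by (simp add: dist_norm norm_minus_commute)
      then have "1 < norm (x - y) * c" using assms(2) by (simp only: pos_divide_less_eq)
      then have "norm (c *\<^sub>R (x - y)) > 1" using assms(2) by (simp only: norm_scaleR abs_of_pos mult.commute)
      then show ?thesis using lp_cutoff_partial_eq_0[OF assms(1)] by (simp add: g_def)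
    qed (use B in force)
    then have "bdd_above (range g)" unfolding bdd_above_def by blast
    then show ?thesis unfolding iter_partial_rescale[OF assms(1) bs] g_def .
  qed
  ultimately show ?thesis unfolding schwartz_def by simp
qed

text \<open>As \<open>ennreal\<close> truncates at 0, the two densities are the positive and the
  negative part of \<open>h\<close>. Their integrals over \<open>A\<close> are finite with
  difference 0.\<close>

lemma emeasure_density_eq_of_integral_eq_0:
  fixes h :: "'a \<Rightarrow> real"
  assumes [measurable]: "h \<in> borel_measurable M" "A \<in> sets M"
    and int: "integrable M (\<lambda>x. h x * indicator A x)" and "(LINT x|M. h x * indicator A x) = 0"
  shows "emeasure (density M (\<lambda>x. ennreal (h x))) A = emeasure (density M (\<lambda>x. ennreal (- h x))) A"
    and "emeasure (density M (\<lambda>x. ennreal (h x))) A < \<infinity>"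
proof -
  let ?p = "\<integral>\<^sup>+x. ennreal (h x * indicator A x) \<partial>M"
  let ?n = "\<integral>\<^sup>+x. ennreal (- (h x * indicator A x)) \<partial>M"
  have e: "emeasure (density M (\<lambda>x. ennreal (h x))) A = ?p"
      "emeasure (density M (\<lambda>x. ennreal (- h x))) A = ?n"
    by (auto simp: emeasure_density intro!: nn_integral_cong split: split_indicator)
  have fin: "?p \<noteq> \<infinity>" "?n \<noteq> \<infinity>" using int by (auto simp: real_integrable_def)
  then have "enn2real ?p = enn2real ?n"
    using assms(4) by (simp add: real_lebesgue_integral_def[OF int])
  then have "?p = ?n"
    using fin by (cases ?p; cases ?n) auto
  then show "emeasure (density M (\<lambda>x. ennreal (h x))) A = emeasure (density M (\<lambda>x. ennreal (- h x))) A"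
    "emeasure (density M (\<lambda>x. ennreal (h x))) A < \<infinity>"
    using e fin by (simp_all add: top.not_eq_extremum)
qed

text \<open>The measures whose densities are the positive and the negative part of \<open>h\<close>
  agree on boxes, an intersection-stable generator, hence everywhere. Uniqueness of densities makes
  the two parts equal almost everywhere, and at each point one of them is 0.\<close>

lemma AE_eq_0_if_box_integrals_eq_0:
  fixes h :: "'a::euclidean_space \<Rightarrow> real"
  assumes [measurable]: "h \<in> borel_measurable borel"
    and "\<And>a b. integrable lborel (\<lambda>x. h x * indicator (box a b) x)"
    and "\<And>a b. (LINT x|lborel. h x * indicator (box a b) x) = 0"
  shows "AE x in lborel. h x = 0"
proof -
  note box = emeasure_density_eq_of_integral_eq_0[OF _ _ assms(2,3)]
  have "density lborel (\<lambda>x. ennreal (h x)) = density lborel (\<lambda>x. ennreal (- h x))"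
  proof (rule measure_eqI_generator_eq)
    let ?E = "range (\<lambda>(a, b). box a b::'a set)"
    show "Int_stable ?E" by (auto simp: Int_stable_def box_Int_box)
    show "?E \<subseteq> Pow UNIV" "sets (density lborel (\<lambda>x. ennreal (h x))) = sigma_sets UNIV ?E"
      "sets (density lborel (\<lambda>x. ennreal (- h x))) = sigma_sets UNIV ?E"
      by (simp_all add: borel_eq_box)
    let ?A = "\<lambda>n::nat. box (- (real n *\<^sub>R One)) (real n *\<^sub>R One) :: 'a set"
    show "range ?A \<subseteq> ?E" "(\<Union>i. ?A i) = UNIV" unfolding UN_box_eq_UNIV by auto
    show "emeasure (density lborel (\<lambda>x. ennreal (h x))) (?A i) \<noteq> \<infinity>" for i
      using box(2)[of "- (real i *\<^sub>R One)" "real i *\<^sub>R One"] by (simp add: less_top)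
    show "emeasure (density lborel (\<lambda>x. ennreal (h x))) X = emeasure (density lborel (\<lambda>x. ennreal (- h x))) X"
      if "X \<in> ?E" for X
      using that box(1) by auto
  qed
  then have "AE x in lborel. ennreal (h x) = ennreal (- h x)"
    by (subst (asm) sigma_finite_measure.density_unique_iff[OF sigma_finite_lborel]) auto
  then show ?thesis
    proof eventually_elim
    case (elim x)
    then show ?case by (cases "h x \<ge> 0") (simp_all add: ennreal_neg)
  qed
qed

text \<open>Serves to give all translates of a reflected cutoff the same mass.\<close>

lemma lborel_integral_translate:
  fixes f :: "'a::euclidean_space \<Rightarrow> real"
  assumes [measurable]: "f \<in> borel_measurable borel"
  shows "(LINT y|lborel. f (x - y)) = (LINT y|lborel. f (- y))"
proof -
  have "(LINT y|lborel. f (x - y)) = (LINT y|distr lborel borel ((+) x). f (x - y))"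
    by (simp add: lborel_distr_plus)
  also have "\<dots> = (LINT y|lborel. f (- y))"
    by (subst integral_distr) auto
  finally show ?thesis .
qed

text \<open>Integrating \<open>\<phi> (c *\<^sub>R (x - y))\<close> over \<open>y\<close> in a box and normalising gives, as \<open>c \<rightarrow> \<infinity>\<close>,
  bounded approximations of the indicator of the box.\<close>

lemma AE_eq_0_if_cutoff_integrals_eq_0:
  fixes \<phi> h :: "'a::euclidean_space \<Rightarrow> real"
  assumes \<phi>: "lp_cutoff \<phi>"
    and h[measurable]: "h \<in> borel_measurable borel"
    and int: "\<And>c y. c > 0 \<Longrightarrow> integrable lborel (\<lambda>x. h x * \<phi> (c *\<^sub>R (x - y)))"
    and zero: "\<And>c y. c > 0 \<Longrightarrow> (LINT x|lborel. h x * \<phi> (c *\<^sub>R (x - y))) = 0"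
  shows "AE x in lborel. h x = 0"
proof -
  have \<phi>_nonneg: "\<phi> x \<ge> 0" and \<phi>_one: "norm x \<le> 1/2 \<Longrightarrow> \<phi> x = 1" and \<phi>_zero: "norm x \<ge> 1 \<Longrightarrow> \<phi> x = 0" for x
    using \<phi> by (auto simp: lp_cutoff_def)
  have far: "\<phi> (c *\<^sub>R (x - y)) = 0" if "c > 0" "y \<notin> ball x (1 / c)" for c and x y :: 'a
  proof (rule \<phi>_zero)
    have "1 / c \<le> norm (x - y)" using that(2) by (simp add: dist_norm)
    then have "1 \<le> norm (x - y) * c" using that(1) by (simp only: pos_divide_le_eq)
    then show "1 \<le> norm (c *\<^sub>R (x - y))" using that(1) by (simp only: norm_scaleR abs_of_pos mult.commute)
  qed
  have \<phi>_cont: "continuous_on S \<phi>" for S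
    using lp_cutoff_continuous[OF \<phi>, of "[]"] by simp
  then have [measurable]: "\<phi> \<in> borel_measurable borel"
    by (intro borel_measurable_continuous_onI)
  have near: "\<phi> (c *\<^sub>R x) = 1" if "c > 0" "norm x \<le> 1 / (2 * c)" for c and x :: 'a
  proof (rule \<phi>_one)
    show "norm (c *\<^sub>R x) \<le> 1 / 2" using mult_left_mono[OF that(2), of c] that(1) by simp
  qed
  \<comment> \<open>A cutoff dilated so as to equal 1 on \<open>ball 0 R\<close> turns the
    hypothesis \<open>int\<close> into local integrability.\<close>
  have loc: "integrable lborel (\<lambda>x. h x * indicator (ball 0 R) x)" if "R > 0" for R
  proof -
    have [measurable]: "ball (0::'a) R \<in> sets borel" by simp
    show ?thesis
    proof (rule Bochner_Integration.integrable_bound)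
      show "integrable lborel (\<lambda>x. h x * \<phi> ((1 / (2 * R)) *\<^sub>R (x - 0)))" by (rule int) (use that in simp)
      show "AE x in lborel. norm (h x * indicator (ball 0 R) x) \<le> norm (h x * \<phi> ((1 / (2 * R)) *\<^sub>R (x - 0)))"
      proof (rule AE_I2)
        fix x
        show "norm (h x * indicator (ball 0 R) x) \<le> norm (h x * \<phi> ((1 / (2 * R)) *\<^sub>R (x - 0)))"
          using near[of "1 / (2 * R)" x] that by (auto split: split_indicator)
      qed
    qed measurable
  qed
  define Z where "Z c = (LINT y|lborel. \<phi> (c *\<^sub>R (- y)))" for c
  have \<phi>_int: "integrable lborel (\<lambda>y. \<phi> (c *\<^sub>R (x - y)))" if "c > 0" for c x
  proof -
    have "integrable lborel (\<lambda>y. indicator (cball x (1/c)) y *\<^sub>R \<phi> (c *\<^sub>R (x - y)))"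
      by (rule borel_integrable_compact[OF compact_cball], rule continuous_on_compose2[OF \<phi>_cont[of UNIV]])
         (intro continuous_intros, simp)
    also have "(\<lambda>y. indicator (cball x (1/c)) y *\<^sub>R \<phi> (c *\<^sub>R (x - y))) = (\<lambda>y. \<phi> (c *\<^sub>R (x - y)))"
      using far[OF that, of _ x] by (auto simp: fun_eq_iff split: split_indicator)
    finally show ?thesis .
  qed
  have Z_eq: "(LINT y|lborel. \<phi> (c *\<^sub>R (x - y))) = Z c" for c x
    using lborel_integral_translate[of "\<lambda>y. \<phi> (c *\<^sub>R y)" x] by (simp add: Z_def)
  have Z_pos: "Z c > 0" if "c > 0" for c
  proof -
    have fin: "emeasure lborel (cball (0::'a) (1/(2*c))) < \<infinity>"
      by (rule emeasure_bounded_finite) simp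
    have "0 < measure lborel (cball (0::'a) (1/(2*c)))"
      using that content_cball_pos[of "1/(2*c)" "0::'a"] by simp
    also have "\<dots> = (LINT y|lborel. indicator (cball (0::'a) (1/(2*c))) y)" by simp
    also have "\<dots> \<le> Z c" unfolding Z_def
    proof (rule integral_mono)
      show "integrable lborel (\<lambda>y. \<phi> (c *\<^sub>R (- y)))" using \<phi>_int[OF that, of 0] by simp
      show "indicator (cball 0 (1/(2*c))) y \<le> \<phi> (c *\<^sub>R (- y))" for y
        using near[OF that, of "- y"] \<phi>_nonneg by (auto split: split_indicator)
    qed (rule integrable_real_indicator[OF _ fin], simp)
    finally show ?thesis .
  qed
  have box0: "(LINT x|lborel. h x * indicator (box a b) x) = 0" for a b :: 'a
  proof -
    define K where "K = box a b"
    have [measurable]: "K \<in> sets borel" by (simp add: K_def)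
    obtain R where R: "R > 0" "K \<subseteq> ball 0 R"
      using bounded_subset_ballD[of K 0] by (auto simp: K_def)
    define \<kappa> where "\<kappa> m x = (LINT y|lborel. indicator K y * \<phi> (real (Suc m) *\<^sub>R (x - y)))" for m x
    have intK: "integrable lborel (\<lambda>y. indicator K y * \<phi> (real (Suc m) *\<^sub>R (x - y)))" for m x
      using integrable_mult_indicator[OF _ \<phi>_int[of "real (Suc m)" x], of K] by simp
    have \<kappa>_nonneg: "\<kappa> m x \<ge> 0" for m x
      unfolding \<kappa>_def by (intro integral_nonneg_AE AE_I2) (auto simp: \<phi>_nonneg)
    have \<kappa>_le: "\<kappa> m x \<le> Z (real (Suc m))" for m x
      unfolding \<kappa>_def Z_eq[of _ x, symmetric]
      by (intro integral_mono intK \<phi>_int) (auto simp: \<phi>_nonneg split: split_indicator)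
    have [measurable]: "\<kappa> m \<in> borel_measurable borel" for m
      unfolding \<kappa>_def by measurable
    have \<kappa>_one: "\<kappa> m x = Z (real (Suc m))" if "ball x (1 / real (Suc m)) \<subseteq> K" for m x
      unfolding \<kappa>_def Z_eq[of _ x, symmetric]
    proof (rule Bochner_Integration.integral_cong)
      fix y
      have "y \<notin> K \<Longrightarrow> \<phi> (real (Suc m) *\<^sub>R (x - y)) = 0"
        using that by (intro far) auto
      then show "indicator K y * \<phi> (real (Suc m) *\<^sub>R (x - y)) = \<phi> (real (Suc m) *\<^sub>R (x - y))"
        by (auto split: split_indicator)
    qed simp
    have \<kappa>_zero: "\<kappa> m x = 0" if "ball x (1 / real (Suc m)) \<inter> K = {}" for m x
    proof -
      have "y \<in> K \<Longrightarrow> \<phi> (real (Suc m) *\<^sub>R (x - y)) = 0" for y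
        using that by (intro far) auto
      then have "(\<lambda>y. indicator K y * \<phi> (real (Suc m) *\<^sub>R (x - y))) = (\<lambda>_. 0)"
        by (auto split: split_indicator)
      then show ?thesis unfolding \<kappa>_def by simp
    qed
    \<comment> \<open>The radius \<open>1 / real (Suc m)\<close> is at most 1, so every
      \<open>\<kappa> m\<close> vanishes outside \<open>ball 0 (R+1)\<close>. After division by
      \<open>Z\<close> this gives one integrable majorant for all \<open>m\<close>.\<close>
    have dom: "norm (h x * \<kappa> m x) \<le> Z (real (Suc m)) * norm (h x * indicator (ball 0 (R+1)) x)" for m x
    proof (cases "x \<in> ball 0 (R + 1)")
      case True
      then show ?thesis using \<kappa>_le[of m x] \<kappa>_nonneg[of m x] by (simp add: abs_mult mult.commute mult_left_mono)
    next
      case False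
      have "ball x (1 / real (Suc m)) \<inter> K = {}"
      proof (rule ccontr)
        assume "ball x (1 / real (Suc m)) \<inter> K \<noteq> {}"
        then obtain y where y: "dist x y < 1 / real (Suc m)" "y \<in> K" by auto
        have "1 / real (Suc m) \<le> 1" by simp
        with y(1) have "dist x y < 1" by linarith
        moreover have "norm y < R" using y(2) R(2) by auto
        ultimately have "norm x < R + 1" using norm_triangle_sub[of x y] by (simp add: dist_norm)
        with False show False by simp
      qed
      moreover have "0 \<le> Z (real (Suc m))" using less_imp_le[OF Z_pos] by simp
      ultimately show ?thesis using \<kappa>_zero by simp
    qed
    \<comment> \<open>After exchanging the integrals by Fubini, the inner one over \<open>x\<close>
      vanishes by the hypothesis \<open>zero\<close> with centre \<open>y\<close>.\<close>
    have h\<kappa>: "(LINT x|lborel. h x * \<kappa> m x) = 0" for m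
    proof -
      let ?f = "\<lambda>(x, y). h x * (indicator K y * \<phi> (real (Suc m) *\<^sub>R (x - y)))"
      have [measurable]: "?f \<in> borel_measurable (lborel \<Otimes>\<^sub>M lborel)" by measurable
      have "integrable (lborel \<Otimes>\<^sub>M lborel) ?f"
      proof (rule lborel_pair.Fubini_integrable)
        have "(LINT y|lborel. norm (?f (x, y))) = norm (h x * \<kappa> m x)" for x
          using \<kappa>_nonneg[of m x] by (simp add: abs_mult \<phi>_nonneg \<kappa>_def)
        moreover have "integrable lborel (\<lambda>x. norm (h x * \<kappa> m x))"
        proof (rule Bochner_Integration.integrable_bound)
          show "integrable lborel (\<lambda>x. Z (real (Suc m)) * norm (h x * indicator (ball 0 (R+1)) x))"
            using R by (intro integrable_mult_right integrable_norm loc) simp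
          show "AE x in lborel. norm (norm (h x * \<kappa> m x)) \<le>
              norm (Z (real (Suc m)) * norm (h x * indicator (ball 0 (R+1)) x))"
            using order_trans[OF dom[of _ m] abs_ge_self] by (intro AE_I2) (simp only: real_norm_def abs_idempotent)
        qed measurable
        ultimately show "integrable lborel (\<lambda>x. LINT y|lborel. norm (?f (x, y)))" by simp
        show "AE x in lborel. integrable lborel (\<lambda>y. ?f (x, y))" using intK by auto
      qed auto
      then have "(LINT x|lborel. LINT y|lborel. ?f (x, y)) = (LINT y|lborel. LINT x|lborel. ?f (x, y))"
        using lborel_pair.Fubini_integral[of "\<lambda>x y. ?f (x, y)"] by simp
      moreover have "(LINT x|lborel. ?f (x, y)) = 0" for y
        using zero[of "real (Suc m)" y] by (simp add: mult.left_commute[of _ "indicator K y"])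
      ultimately show ?thesis unfolding \<kappa>_def by simp
    qed
    have "(\<lambda>m. LINT x|lborel. h x * (\<kappa> m x / Z (real (Suc m)))) \<longlonglongrightarrow> (LINT x|lborel. h x * indicator K x)"
    proof (rule integral_dominated_convergence)
      show "integrable lborel (\<lambda>x. norm (h x * indicator (ball 0 (R+1)) x))"
        using loc[of "R+1"] R by (intro integrable_norm) auto
      show "AE x in lborel. norm (h x * (\<kappa> m x / Z (real (Suc m)))) \<le> norm (h x * indicator (ball 0 (R+1)) x)" for m
        using dom[of _ m] Z_pos[of "real (Suc m)"] by (intro AE_I2) (simp add: field_simps)
      \<comment> \<open>The faces of the box form a null set. Any other point has a ball inside the
        box or outside the closed box, so the normalised \<open>\<kappa> m x\<close> is eventually
        equal to the indicator.\<close>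
      have "AE x in lborel. x \<notin> cbox a b - box a b"
        using null_sets_cbox_Diff_box AE_not_in by blast
      then show "AE x in lborel. (\<lambda>m. h x * (\<kappa> m x / Z (real (Suc m)))) \<longlonglongrightarrow> h x * indicator K x"
      proof eventually_elim
        case (elim x)
        define S where "S = (if x \<in> K then K else - cbox a b)"
        have "open S" "x \<in> S" using elim by (auto simp: S_def K_def open_Compl)
        then obtain e where e: "e > 0" "ball x e \<subseteq> S" using open_contains_ball by blast
        have "eventually (\<lambda>m. 1 / real (Suc m) < e) sequentially"
          using order_tendstoD(2)[OF LIMSEQ_inverse_real_of_nat e(1)] by (simp add: inverse_eq_divide)
        then have "eventually (\<lambda>m. h x * (\<kappa> m x / Z (real (Suc m))) = h x * indicator K x) sequentially"
        proof eventually_elim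
          case (elim m)
          then have S: "ball x (1 / real (Suc m)) \<subseteq> S" using e(2) by force
          have "K \<subseteq> cbox a b" by (auto simp: K_def box_subset_cbox)
          then show ?case
            using S \<kappa>_one[of x m] \<kappa>_zero[of x m] Z_pos[of "real (Suc m)"]
            by (cases "x \<in> K") (auto simp: S_def)
        qed
        then show ?case by (rule tendsto_eventually)
      qed
    qed auto
    moreover have "(LINT x|lborel. h x * (\<kappa> m x / Z (real (Suc m)))) = 0" for m
      using h\<kappa>[of m] by (simp del: of_nat_Suc)
    ultimately have "(\<lambda>m. 0) \<longlonglongrightarrow> (LINT x|lborel. h x * indicator K x)" by (simp only:)
    then show ?thesis by (simp add: LIMSEQ_const_iff K_def)
  qed
  show ?thesis
  proof (rule AE_eq_0_if_box_integrals_eq_0[OF h _ box0])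
    fix a b :: 'a
    obtain R where R: "R > 0" "box a b \<subseteq> ball 0 R"
      using bounded_subset_ballD[of "box a b" 0] by auto
    show "integrable lborel (\<lambda>x. h x * indicator (box a b) x)"
    proof (rule Bochner_Integration.integrable_bound[OF loc[OF R(1)]])
      show "AE x in lborel. norm (h x * indicator (box a b) x) \<le> norm (h x * indicator (ball 0 R) x)"
        by (rule AE_I2) (use R(2) in \<open>auto simp del: mem_ball split: split_indicator\<close>)
    qed auto
  qed
qed

text \<open>The difference integrates to 0 against every rescaled cutoff, as these are Schwartz
  functions. Real and imaginary part are treated separately because the cutoff is real.\<close>

lemma represents_AE_unique:
  fixes \<phi> :: "'a::euclidean_space \<Rightarrow> real" and f g :: "'a \<Rightarrow> complex"
  assumes \<phi>: "lp_cutoff \<phi>" and f: "represents f u" and g: "represents g u"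
  shows "AE x in lborel. f x = g x"
proof -
  have [measurable]: "f \<in> borel_measurable borel" "g \<in> borel_measurable borel"
    using f g by (auto simp: represents_def)
  define h where "h x = f x - g x" for x
  have h: "integrable lborel (\<lambda>x. h x * complex_of_real (\<phi> (c *\<^sub>R (x - y))))"
     "(LINT x|lborel. h x * complex_of_real (\<phi> (c *\<^sub>R (x - y)))) = 0" if "c > 0" for c y
    using f g lp_cutoff_rescaled_schwartz[OF \<phi> that, of y]
    by (auto simp: represents_def h_def left_diff_distrib)
  have "AE x in lborel. Re (h x) = 0"
  proof (rule AE_eq_0_if_cutoff_integrals_eq_0[OF \<phi>])
    fix c :: real and y :: 'a assume "c > 0"
    from integrable_Re[OF h(1)[OF this, of y]] integral_Re[OF h(1)[OF this, of y]] h(2)[OF this, of y]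
    show "integrable lborel (\<lambda>x. Re (h x) * \<phi> (c *\<^sub>R (x - y)))"
      "(LINT x|lborel. Re (h x) * \<phi> (c *\<^sub>R (x - y))) = 0" by simp_all
  qed (simp add: h_def)
  moreover have "AE x in lborel. Im (h x) = 0"
  proof (rule AE_eq_0_if_cutoff_integrals_eq_0[OF \<phi>])
    fix c :: real and y :: 'a assume "c > 0"
    from integrable_Im[OF h(1)[OF this, of y]] integral_Im[OF h(1)[OF this, of y]] h(2)[OF this, of y]
    show "integrable lborel (\<lambda>x. Im (h x) * \<phi> (c *\<^sub>R (x - y)))"
      "(LINT x|lborel. Im (h x) * \<phi> (c *\<^sub>R (x - y))) = 0" by simp_all
  qed (simp add: h_def)
  ultimately show ?thesis
    by eventually_elim (simp add: complex_eq_iff h_def)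
qed

section \<open>Averages and rearrangements\<close>

lemma epowr_ennreal: "x \<ge> 0 \<Longrightarrow> ennreal x epowr a = ennreal (x powr a)"
  by (simp add: epowr_def)

lemma epowr_mono: "0 \<le> a \<Longrightarrow> x \<le> y \<Longrightarrow> x epowr a \<le> y epowr a"
  by (cases x; cases y) (auto simp: epowr_def ennreal_le_iff powr_mono2 top_unique)

lemma epowr_epowr: "a \<noteq> 0 \<Longrightarrow> (x epowr a) epowr b = x epowr (a * b)"
  by (cases x) (auto simp: epowr_def powr_powr)

lemma epowr_one: "x epowr 1 = x"
  by (cases x) (auto simp: epowr_def)

lemma le_ennreal_powr_if_epowr_le:
  assumes "q > 0" and "x epowr (1 / q) \<le> ennreal N"
  shows "x \<le> ennreal N epowr q"
  using epowr_mono[OF _ assms(2), of q] assms(1) by (simp add: epowr_epowr epowr_one)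

text \<open>The inequality \<open>t \<le> 1 + t powr q\<close> at \<open>t = x / M\<close>; with a suitable \<open>M\<close> it replaces Hoelder's inequality.\<close>

lemma le_add_powr:
  fixes x M q :: real
  assumes "x \<ge> 0" "M > 0" "q \<ge> 1"
  shows "x \<le> M + M powr (1 - q) * x powr q"
proof (cases "x \<le> M")
  case True
  then show ?thesis using assms by (simp add: add_increasing2)
next
  case False
  then have "1 \<le> (x / M) powr (q - 1)" using assms by (simp add: ge_one_powr_ge_zero)
  then have "x \<le> x * (x / M) powr (q - 1)" using assms by (simp add: mult_le_cancel_left1)
  also have "\<dots> = M powr (1 - q) * x powr q"
    using False assms by (simp add: powr_divide powr_diff field_simps)
  finally show ?thesis using assms by simp
qed

text \<open>Integrate \<open>le_add_powr\<close> with \<open>M = N * \<kappa>\<close> against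
  \<open>w\<close>, bounding \<open>w\<close> by \<open>W\<close> in the term with the power. The
  parameter \<open>\<kappa>\<close> balances the two terms: it will be 1 for a general weight and a
  power of the measure for a set.\<close>

lemma nn_integral_weight_le:
  fixes u :: "'a::euclidean_space \<Rightarrow> complex" and w :: "'a \<Rightarrow> ennreal"
  assumes [measurable]: "u \<in> borel_measurable borel" "w \<in> borel_measurable borel"
    and q: "1 \<le> q" "q < \<infinity>" and N: "0 \<le> N" "lebesgue_norm q u \<le> ennreal N"
    and \<kappa>: "\<kappa> > 0" and W: "\<And>x. w x \<le> W"
  shows "(\<integral>\<^sup>+x. ennreal (norm (u x)) * w x \<partial>lborel) \<le>
    ennreal (N * \<kappa>) * (\<integral>\<^sup>+x. w x \<partial>lborel) + ennreal (N * \<kappa> powr (1 - enn2real q)) * W"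
proof -
  obtain Q where Q: "q = ennreal Q" "Q \<ge> 1"
    using q by (cases q) auto
  have pw: "(\<integral>\<^sup>+x. ennreal (norm (u x) powr Q) \<partial>lborel) \<le> ennreal (N powr Q)"
    using le_ennreal_powr_if_epowr_le[of Q _ N] N Q
    by (simp add: lebesgue_norm_def epowr_ennreal split: if_splits)
  show ?thesis
  proof (cases "N = 0")
    \<comment> \<open>Here \<open>N * \<kappa>\<close> would not be a positive \<open>M\<close>;
      instead \<open>u\<close> vanishes wherever integration sees it.\<close>
    case True
    with pw have "AE x in lborel. ennreal (norm (u x) powr Q) = 0"
      by (simp add: nn_integral_0_iff_AE)
    then have "AE x in lborel. ennreal (norm (u x)) * w x = 0"
      by eventually_elim simp
    then have "(\<integral>\<^sup>+x. ennreal (norm (u x)) * w x \<partial>lborel) = 0"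
      by (simp add: nn_integral_0_iff_AE)
    then show ?thesis by simp
  next
    case False
    define M where "M = N * \<kappa>"
    have M: "M > 0" "M powr (1 - Q) * N powr Q = N * \<kappa> powr (1 - Q)"
      using False N \<kappa> by (auto simp: M_def powr_mult powr_diff)
    have "(\<integral>\<^sup>+x. ennreal (norm (u x)) * w x \<partial>lborel) \<le>
        (\<integral>\<^sup>+x. ennreal M * w x + ennreal (M powr (1 - Q)) * (ennreal (norm (u x) powr Q) * W) \<partial>lborel)"
    proof (rule nn_integral_mono)
      fix x
      have "ennreal (norm (u x)) \<le> ennreal (M + M powr (1 - Q) * norm (u x) powr Q)"
        using le_add_powr[OF norm_ge_zero M(1) Q(2)] by (intro ennreal_leI)
      also have "\<dots> = ennreal M + ennreal (M powr (1 - Q)) * ennreal (norm (u x) powr Q)"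
        using M(1) by (simp add: ennreal_plus ennreal_mult)
      finally have "ennreal (norm (u x)) * w x \<le> (ennreal M + ennreal (M powr (1 - Q)) * ennreal (norm (u x) powr Q)) * w x"
        by (rule mult_right_mono) simp
      also have "\<dots> = ennreal M * w x + ennreal (M powr (1 - Q)) * (ennreal (norm (u x) powr Q) * w x)"
        by (simp add: algebra_simps)
      also have "\<dots> \<le> ennreal M * w x + ennreal (M powr (1 - Q)) * (ennreal (norm (u x) powr Q) * W)"
        by (intro add_mono mult_left_mono order_refl W) auto
      finally show "ennreal (norm (u x)) * w x \<le>
        ennreal M * w x + ennreal (M powr (1 - Q)) * (ennreal (norm (u x) powr Q) * W)" .
    qed
    also have "\<dots> = ennreal M * (\<integral>\<^sup>+x. w x \<partial>lborel) +
        ennreal (M powr (1 - Q)) * ((\<integral>\<^sup>+x. ennreal (norm (u x) powr Q) \<partial>lborel) * W)"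
      by (simp add: nn_integral_add nn_integral_cmult nn_integral_multc)
    also have "\<dots> \<le> ennreal M * (\<integral>\<^sup>+x. w x \<partial>lborel) + ennreal (M powr (1 - Q)) * (ennreal (N powr Q) * W)"
      by (intro add_mono mult_left_mono mult_right_mono pw order_refl) auto
    also have "\<dots> = ennreal M * (\<integral>\<^sup>+x. w x \<partial>lborel) + ennreal (M powr (1 - Q) * N powr Q) * W"
      by (simp add: ennreal_mult mult.assoc)
    finally show ?thesis unfolding M(2) using Q(2) by (simp add: M_def Q(1))
  qed
qed

lemma AE_norm_le_if_lebesgue_norm_infinity_le:
  assumes "lebesgue_norm \<infinity> u \<le> ennreal N"
  shows "AE x in lborel. ennreal (norm (u x)) \<le> ennreal N"
  using esssup_AE[of "\<lambda>x. ennreal (norm (u x))" lborel] by eventually_elim (use assms in \<open>auto simp: lebesgue_norm_def\<close>)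

text \<open>With the convention that the reciprocal of infinity is 0,
  \<open>enn2real (1 / q)\<close> serves as the real exponent belonging to \<open>q\<close>
  throughout.\<close>

lemma enn2real_recip:
  assumes "1 \<le> q"
  shows "enn2real (1 / q) = (if q = \<infinity> then 0 else 1 / enn2real q)"
  using assms by (cases q) (auto simp: divide_ennreal simp flip: ennreal_1)

text \<open>The choice \<open>\<kappa> = 1\<close> yields a constant independent of
  \<open>q\<close>, so that blocks measured in different Lebesgue norms can be summed.\<close>

lemma nn_integral_weight_le_uniform:
  fixes u :: "'a::euclidean_space \<Rightarrow> complex" and w :: "'a \<Rightarrow> ennreal"
  assumes [measurable]: "u \<in> borel_measurable borel" "w \<in> borel_measurable borel"
    and q: "1 \<le> q" and N: "0 \<le> N" "lebesgue_norm q u \<le> ennreal N"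
    and W: "\<And>x. w x \<le> W"
  shows "(\<integral>\<^sup>+x. ennreal (norm (u x)) * w x \<partial>lborel) \<le> ennreal N * ((\<integral>\<^sup>+x. w x \<partial>lborel) + W)"
proof (cases "q = \<infinity>")
  case True
  have "AE x in lborel. ennreal (norm (u x)) * w x \<le> ennreal N * w x"
    using AE_norm_le_if_lebesgue_norm_infinity_le[OF N(2)[unfolded True]]
    by eventually_elim (simp add: mult_right_mono)
  then have "(\<integral>\<^sup>+x. ennreal (norm (u x)) * w x \<partial>lborel) \<le> (\<integral>\<^sup>+x. ennreal N * w x \<partial>lborel)"
    by (rule nn_integral_mono_AE)
  also have "\<dots> = ennreal N * (\<integral>\<^sup>+x. w x \<partial>lborel)" by (simp add: nn_integral_cmult)
  also have "\<dots> \<le> ennreal N * ((\<integral>\<^sup>+x. w x \<partial>lborel) + W)" by (intro mult_left_mono) auto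
  finally show ?thesis .
next
  case False
  then show ?thesis
    using nn_integral_weight_le[OF assms(1,2) q _ N, of 1 W] W by (simp add: less_top distrib_left)
qed

text \<open>With \<open>\<kappa> = m powr (- 1 / Q)\<close> both terms of
  \<open>nn_integral_weight_le\<close> equal \<open>m * \<kappa> * N\<close>, whence the factor 2.
  For infinite \<open>q\<close> the factor is kept for a uniform statement.\<close>

lemma nn_integral_set_le:
  fixes u :: "'a::euclidean_space \<Rightarrow> complex"
  assumes [measurable]: "u \<in> borel_measurable borel" "E \<in> sets borel"
    and q: "1 \<le> q" and N: "0 \<le> N" "lebesgue_norm q u \<le> ennreal N"
    and m: "m > 0" "emeasure lborel E = ennreal m"
  shows "(\<integral>\<^sup>+x. ennreal (norm (u x)) * indicator E x \<partial>lborel) \<le>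
    ennreal m * ennreal (2 * (m powr - enn2real (1 / q) * N))"
proof (cases "q = \<infinity>")
  case True
  have "AE x in lborel. ennreal (norm (u x)) * indicator E x \<le> ennreal N * indicator E x"
    using AE_norm_le_if_lebesgue_norm_infinity_le[OF N(2)[unfolded True]]
    by eventually_elim (simp add: mult_right_mono)
  then have "(\<integral>\<^sup>+x. ennreal (norm (u x)) * indicator E x \<partial>lborel) \<le> (\<integral>\<^sup>+x. ennreal N * indicator E x \<partial>lborel)"
    by (rule nn_integral_mono_AE)
  also have "\<dots> = ennreal m * ennreal N" by (simp add: nn_integral_cmult_indicator m mult.commute)
  also have "\<dots> \<le> ennreal m * ennreal (2 * N)" using N by (intro mult_left_mono ennreal_leI) auto
  finally show ?thesis using True m by (simp add: enn2real_recip)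
next
  case False
  then obtain Q where Q: "q = ennreal Q" "Q \<ge> 1"
    using q by (cases q) auto
  define \<kappa> where "\<kappa> = m powr (- 1 / Q)"
  have \<kappa>: "\<kappa> > 0" "\<kappa> powr (1 - Q) = m * \<kappa>"
    using m Q by (simp_all add: \<kappa>_def powr_powr powr_mult_base diff_divide_distrib)
  have W: "indicator E x \<le> (1::ennreal)" for x by (simp split: split_indicator)
  have "(\<integral>\<^sup>+x. ennreal (norm (u x)) * indicator E x \<partial>lborel) \<le>
     ennreal (N * \<kappa>) * ennreal m + ennreal (N * (m * \<kappa>)) * 1"
    using nn_integral_weight_le[where w = "indicator E" and W = 1, OF assms(1) _ q _ N \<kappa>(1) W] False Q m(2) \<kappa>(2)
    by (simp add: less_top)
  also have "\<dots> = ennreal (m * (2 * (\<kappa> * N)))"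
    using N m \<kappa>(1) by (simp add: ennreal_mult[symmetric] ennreal_plus[symmetric] algebra_simps del: ennreal_plus)
  finally show ?thesis
    using m N Q False by (simp add: ennreal_mult \<kappa>_def enn2real_recip)
qed

text \<open>A weight dominating every Schwartz function up to a constant. The volume of balls takes
  up \<open>DIM('a)\<close> of the powers in the denominator, and the remaining two make the weight
  integrable.\<close>

definition decay :: "'a::euclidean_space \<Rightarrow> real" where
  "decay x = 1 / (1 + norm x) ^ (DIM('a) + 2)"

lemma decay_pos: "decay x > 0"
  by (simp add: decay_def add_pos_nonneg)

lemma decay_le_1: "decay (x :: 'a::euclidean_space) \<le> 1"
proof -
  have "1 \<le> (1 + norm x) ^ (DIM('a) + 2)" by (rule one_le_power) simp
  then show ?thesis unfolding decay_def divide_le_eq_1 by linarith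
qed

lemma decay_measurable [measurable]: "decay \<in> borel_measurable borel"
  unfolding decay_def by measurable

text \<open>At \<open>x\<close> the single term whose index is the integer part of
  \<open>norm x\<close> already dominates \<open>decay x\<close>. Integrating over the balls leaves
  a multiple of the convergent series of inverse squares.\<close>

lemma nn_integral_decay_finite: "(\<integral>\<^sup>+x. ennreal (decay (x::'a::euclidean_space)) \<partial>lborel) < \<infinity>"
proof -
  have le_suminf: "f m \<le> (\<Sum>m. f m)" for f :: "nat \<Rightarrow> ennreal" and m
    using sum_le_suminf[OF summableI, of "{m}" f] by simp
  have [measurable]: "ball (0::'a) r \<in> sets borel" for r by simp
  define c where "c m = 1 / real (Suc m) ^ (DIM('a) + 2)" for m
  have "(\<integral>\<^sup>+x. ennreal (decay (x::'a)) \<partial>lborel) \<le>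
      (\<integral>\<^sup>+x. (\<Sum>m. ennreal (c m) * indicator (ball 0 (real (Suc m))) (x::'a)) \<partial>lborel)"
  proof (rule nn_integral_mono)
    fix x :: 'a
    define m where "m = nat \<lfloor>norm x\<rfloor>"
    have "real m = of_int \<lfloor>norm x\<rfloor>" by (simp add: m_def)
    then have m: "real m \<le> norm x" "norm x < real (Suc m)" by linarith+
    have "decay x \<le> c m"
      unfolding decay_def c_def using m by (intro divide_left_mono power_mono mult_pos_pos zero_less_power add_pos_nonneg) auto
    then have "ennreal (decay x) \<le> ennreal (c m) * indicator (ball 0 (real (Suc m))) x"
      using m by (simp add: ennreal_leI)
    also have "\<dots> \<le> (\<Sum>m. ennreal (c m) * indicator (ball 0 (real (Suc m))) x)"
      by (rule le_suminf)
    finally show "ennreal (decay x) \<le> (\<Sum>m. ennreal (c m) * indicator (ball 0 (real (Suc m))) x)" .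
  qed
  also have "\<dots> = (\<Sum>m. ennreal (c m) * emeasure lborel (ball (0::'a) (real (Suc m))))"
    by (subst nn_integral_suminf, measurable) (simp add: nn_integral_cmult_indicator)
  also have "\<dots> = (\<Sum>m. ennreal (unit_ball_vol DIM('a) * (1 / (real (Suc m))\<^sup>2)))"
  proof (rule suminf_cong)
    fix m
    show "ennreal (c m) * emeasure lborel (ball (0::'a) (real (Suc m))) =
        ennreal (unit_ball_vol DIM('a) * (1 / (real (Suc m))\<^sup>2))"
      by (subst emeasure_ball) (simp_all add: c_def ennreal_mult'[symmetric] power_add power2_eq_square)
  qed
  also have "\<dots> < \<infinity>"
  proof -
    have "summable (\<lambda>m. 1 / (real (Suc m))\<^sup>2)"
      using summable_Suc_iff[of "\<lambda>n. inverse ((real n)\<^sup>2)"] inverse_power_summable[of 2, where 'a=real]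
      by (simp add: inverse_eq_divide del: of_nat_Suc)
    then have "summable (\<lambda>m. unit_ball_vol DIM('a) * (1 / (real (Suc m))\<^sup>2))"
      by (rule summable_mult)
    then show ?thesis by (subst suminf_ennreal2) auto
  qed
  finally show ?thesis .
qed

lemma nn_integral_decay_weight_le:
  obtains C where "C \<ge> 0"
    and "\<And>q N (u :: 'a::euclidean_space \<Rightarrow> complex). \<lbrakk>u \<in> borel_measurable borel; 1 \<le> q; 0 \<le> N; lebesgue_norm q u \<le> ennreal N\<rbrakk> \<Longrightarrow>
      (\<integral>\<^sup>+x. ennreal (norm (u x)) * ennreal (decay x) \<partial>lborel) \<le> ennreal (C * N)"
proof -
  obtain D where D: "(\<integral>\<^sup>+x. ennreal (decay (x::'a)) \<partial>lborel) = ennreal D" "D \<ge> 0"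
    using nn_integral_decay_finite[where 'a='a] by (cases "\<integral>\<^sup>+x. ennreal (decay (x::'a)) \<partial>lborel") auto
  show ?thesis
  proof (rule that[of "D + 1"])
    fix q N and u :: "'a \<Rightarrow> complex"
    assume u: "u \<in> borel_measurable borel" "1 \<le> q" "0 \<le> N" "lebesgue_norm q u \<le> ennreal N"
    have "(\<integral>\<^sup>+x. ennreal (norm (u x)) * ennreal (decay x) \<partial>lborel) \<le> ennreal N * (ennreal D + 1)"
      using nn_integral_weight_le_uniform[OF u(1) _ u(2-4), of "\<lambda>x. ennreal (decay x)" 1]
      by (simp add: D decay_le_1)
    also have "\<dots> = ennreal ((D + 1) * N)"
      using D u by (simp add: ennreal_mult mult.commute)
    finally show "(\<integral>\<^sup>+x. ennreal (norm (u x)) * ennreal (decay x) \<partial>lborel) \<le> ennreal ((D + 1) * N)" .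
  qed (use D in simp)
qed

section \<open>Measurability and decay of Schwartz functions\<close>

lemma schwartz_borel_measurable:
  assumes "schwartz \<eta>" shows "\<eta> \<in> borel_measurable borel"
proof -
  have "\<eta> differentiable (at x)" for x
    using assms by (force simp: schwartz_def smooth_def dest: spec[of _ "[]"])
  then show ?thesis
    by (intro borel_measurable_continuous_onI continuous_at_imp_continuous_on) (auto intro: differentiable_imp_continuous_within)
qed

lemma schwartz_decay:
  fixes \<eta> :: "'a::euclidean_space \<Rightarrow> complex"
  assumes "schwartz \<eta>"
  obtains C where "C \<ge> 0" "\<And>x. norm (\<eta> x) \<le> C * decay x"
proof -
  have "bdd_above (range (\<lambda>x. (1 + norm x) ^ (DIM('a) + 2) * norm (iter_partial [] \<eta> x)))"
    using assms unfolding schwartz_def by (metis empty_set empty_subsetI)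
  then obtain C where C: "(1 + norm x) ^ (DIM('a) + 2) * norm (\<eta> x) \<le> C" for x
    unfolding bdd_above_def by auto
  have "0 \<le> C" using order_trans[OF norm_ge_zero C[of 0, simplified]] .
  moreover have "norm (\<eta> x) \<le> C * decay x" for x
    using C[of x] by (simp add: decay_def pos_le_divide_eq add_pos_nonneg mult.commute)
  ultimately show ?thesis by (rule that)
qed

text \<open>Continuity of the measure along intersections with growing balls. A superlevel set may
  have infinite measure, whereas the averaging bound is for a set of finite measure.\<close>

lemma emeasure_gt_imp_finite_subset:
  fixes A :: "'a::euclidean_space set"
  assumes [measurable]: "A \<in> sets borel" and "ennreal s < emeasure lborel A" "s \<ge> 0"
  obtains E m where "E \<subseteq> A" "E \<in> sets borel" "emeasure lborel E = ennreal m" "s < m"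
proof -
  have "(SUP n::nat. emeasure lborel (A \<inter> ball 0 (real n))) = emeasure lborel (\<Union>n::nat. A \<inter> ball 0 (real n))"
    by (intro SUP_emeasure_incseq) (auto simp: incseq_def)
  also have "(\<Union>n::nat. A \<inter> ball 0 (real n)) = A"
    using reals_Archimedean2 by auto
  finally have SUP_eq: "(SUP n::nat. emeasure lborel (A \<inter> ball 0 (real n))) = emeasure lborel A" .
  obtain n :: nat where n: "ennreal s < emeasure lborel (A \<inter> ball 0 (real n))"
    using assms(2)[folded SUP_eq] unfolding less_SUP_iff by blast
  have "emeasure lborel (A \<inter> ball 0 (real n)) < \<infinity>"
    by (intro emeasure_bounded_finite) auto
  then obtain m where "emeasure lborel (A \<inter> ball 0 (real n)) = ennreal m" "m \<ge> 0"
    by (cases "emeasure lborel (A \<inter> ball 0 (real n))") auto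
  then show ?thesis using n assms(3) by (intro that[of "A \<inter> ball 0 (real n)" m]) (auto simp: ennreal_less_iff)
qed

text \<open>If \<open>norm (g x)\<close> were at least some \<open>t > ?D\<close> on a set of
  measure above \<open>s\<close>, its mean over a subset of finite measure \<open>m > s\<close>
  would be at least \<open>t\<close>. But \<open>nn_integral_set_le\<close> bounds that mean by the
  same sum with \<open>m\<close> for \<open>s\<close>, which is at most \<open>?D\<close> since the
  exponents are not positive. The exponent may vary with \<open>j\<close>; this is what allows a cut
  at an index \<open>J\<close>.\<close>

lemma decr_rearrangement_le:
  fixes u :: "int \<Rightarrow> 'a::euclidean_space \<Rightarrow> complex" and g :: "'a \<Rightarrow> complex"
  assumes [measurable]: "\<And>j. u j \<in> borel_measurable borel" "g \<in> borel_measurable borel"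
    and g: "AE x in lborel. ennreal (norm (g x)) \<le> (\<integral>\<^sup>+j. ennreal (norm (u j x)) \<partial>count_space UNIV)"
    and q: "\<And>j. 1 \<le> q j" and N: "\<And>j. 0 \<le> N j" "\<And>j. lebesgue_norm (q j) (u j) \<le> ennreal (N j)"
    and s: "s > 0"
  shows "decr_rearrangement g s \<le> (\<integral>\<^sup>+j. ennreal (2 * (s powr - enn2real (1 / q j) * N j)) \<partial>count_space UNIV)"
    (is "_ \<le> ?D")
proof (cases ?D)
  case (real d)
  have "distribution_fun g t \<le> ennreal s" if "t > d" for t
  proof (rule ccontr)
    assume "\<not> distribution_fun g t \<le> ennreal s"
    then have gt: "ennreal s < emeasure lborel {x. norm (g x) \<ge> t}" by (simp add: distribution_fun_def)
    have meas: "{x. norm (g x) \<ge> t} \<in> sets borel" by measurable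
    obtain E m where E: "E \<subseteq> {x. norm (g x) \<ge> t}" "E \<in> sets borel" "emeasure lborel E = ennreal m" "s < m"
      by (rule emeasure_gt_imp_finite_subset[OF meas gt less_imp_le[OF s]])
    note [measurable] = E(2)
    have "ennreal t * ennreal m = (\<integral>\<^sup>+x. ennreal t * indicator E x \<partial>lborel)"
      by (simp add: nn_integral_cmult_indicator E)
    also have "\<dots> \<le> (\<integral>\<^sup>+x. (\<integral>\<^sup>+j. ennreal (norm (u j x)) * indicator E x \<partial>count_space UNIV) \<partial>lborel)"
    proof (rule nn_integral_mono_AE)
      show "AE x in lborel. ennreal t * indicator E x \<le> (\<integral>\<^sup>+j. ennreal (norm (u j x)) * indicator E x \<partial>count_space UNIV)"
        using g
      proof eventually_elim
        case (elim x)
        show ?case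
        proof (cases "x \<in> E")
          case True
          then have "ennreal t \<le> ennreal (norm (g x))" using E(1) by (intro ennreal_leI) auto
          from order_trans[OF this elim] show ?thesis using True by simp
        qed simp
      qed
    qed
    also have "\<dots> = (\<integral>\<^sup>+j. (\<integral>\<^sup>+x. ennreal (norm (u j x)) * indicator E x \<partial>lborel) \<partial>count_space UNIV)"
      by (rule nn_integral_count_space_nn_integral) auto
    also have "\<dots> \<le> (\<integral>\<^sup>+j. ennreal m * ennreal (2 * (s powr - enn2real (1 / q j) * N j)) \<partial>count_space UNIV)"
    proof (rule nn_integral_mono)
      fix j
      have "(\<integral>\<^sup>+x. ennreal (norm (u j x)) * indicator E x \<partial>lborel) \<le>
          ennreal m * ennreal (2 * (m powr - enn2real (1 / q j) * N j))"
        using E s by (intro nn_integral_set_le q N) auto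
      also have "m powr - enn2real (1 / q j) \<le> s powr - enn2real (1 / q j)"
        using E s by (intro powr_mono2') auto
      then have "ennreal m * ennreal (2 * (m powr - enn2real (1 / q j) * N j)) \<le>
          ennreal m * ennreal (2 * (s powr - enn2real (1 / q j) * N j))"
        using N(1)[of j] by (intro mult_left_mono ennreal_leI mult_right_mono) auto
      finally show "(\<integral>\<^sup>+x. ennreal (norm (u j x)) * indicator E x \<partial>lborel) \<le>
          ennreal m * ennreal (2 * (s powr - enn2real (1 / q j) * N j))" .
    qed
    also have "\<dots> = ennreal d * ennreal m"
      by (subst nn_integral_cmult, simp, unfold real(2), rule mult.commute)
    finally have "ennreal (t * m) \<le> ennreal (d * m)"
      using real that E s by (simp add: ennreal_mult'')
    then have "t * m \<le> d * m" using real E s by (subst (asm) ennreal_le_iff) auto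
    then show False using that E s by simp
  qed
  then have "decr_rearrangement g s \<le> ennreal t" if "t > d" for t
    unfolding decr_rearrangement_def using that real by (intro INF_lower) auto
  then have "decr_rearrangement g s \<le> ennreal d + ennreal e" if "e > 0" for e
    using that real by (simp add: ennreal_plus[symmetric] del: ennreal_plus)
  then show ?thesis unfolding real(2) by (rule ennreal_le_epsilon)
qed simp

section \<open>Summation of the dyadic blocks\<close>

lemma sum_le_nn_integral_count_space:
  fixes f :: "'i \<Rightarrow> ennreal"
  assumes "finite F"
  shows "(\<Sum>j\<in>F. f j) \<le> (\<integral>\<^sup>+j. f j \<partial>count_space UNIV)"
proof -
  have "(\<Sum>j\<in>F. f j) = (\<integral>\<^sup>+j. f j * indicator F j \<partial>count_space UNIV)"
    using assms by (simp add: nn_integral_count_space_indicator[symmetric] nn_integral_count_space_finite)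
  also have "\<dots> \<le> (\<integral>\<^sup>+j. f j \<partial>count_space UNIV)"
    by (rule nn_integral_mono) (simp split: split_indicator)
  finally show ?thesis .
qed

text \<open>Dominated convergence for the counting measure, with majorant
  \<open>norm (c j)\<close>.\<close>

lemma symmetric_sums_tendsto:
  fixes c :: "int \<Rightarrow> complex"
  assumes c: "integrable (count_space UNIV) c"
  shows "(\<lambda>n. \<Sum>j\<in>{- int n..int n}. c j) \<longlonglongrightarrow> (LINT j|count_space UNIV. c j)"
proof -
  have "(\<lambda>n. LINT j|count_space UNIV. indicator {- int n..int n} j *\<^sub>R c j) \<longlonglongrightarrow> (LINT j|count_space UNIV. c j)"
  proof (rule integral_dominated_convergence)
    show "integrable (count_space UNIV) (\<lambda>j. norm (c j))" using c by (rule integrable_norm)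
    show "AE j in count_space UNIV. (\<lambda>n. indicator {- int n..int n} j *\<^sub>R c j) \<longlonglongrightarrow> c j"
    proof (rule AE_I2)
      fix j
      have "\<forall>n\<ge>nat \<bar>j\<bar>. indicator {- int n..int n} j *\<^sub>R c j = c j"
        by (intro allI impI) (subst indicator_eq_1_iff[THEN iffD2], auto)
      then show "(\<lambda>n. indicator {- int n..int n} j *\<^sub>R c j) \<longlonglongrightarrow> c j"
        by (intro tendsto_eventually eventually_sequentiallyI[of "nat \<bar>j\<bar>"]) blast
    qed
  qed (auto split: split_indicator)
  moreover have "(LINT j|count_space UNIV. indicator {- int n..int n} j *\<^sub>R c j) = (\<Sum>j\<in>{- int n..int n}. c j)" for n
  proof -
    have "(LINT j|count_space UNIV. indicator {- int n..int n} j *\<^sub>R c j) =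
        (\<Sum>j | j \<in> UNIV \<and> indicator {- int n..int n} j *\<^sub>R c j \<noteq> 0. indicator {- int n..int n} j *\<^sub>R c j)"
      by (rule lebesgue_integral_count_space_finite_support)
         (rule finite_subset[of _ "{- int n..int n}"], auto split: split_indicator_asm)
    also have "\<dots> = (\<Sum>j\<in>{- int n..int n}. c j)"
      by (rule sum.mono_neutral_cong_left) (auto split: split_indicator_asm)
    finally show ?thesis .
  qed
  ultimately show ?thesis by simp
qed

text \<open>The sum \<open>S\<close> of all \<open>norm (u j x)\<close> is integrable against
  \<open>decay\<close>, hence finite almost everywhere, and there the symmetric partial sums
  converge to some \<open>g\<close>. Multiplied by a Schwartz function they are dominated by a
  multiple of \<open>S\<close> times \<open>decay\<close>, so the limit passes under the integral
  and identifies \<open>g\<close> with \<open>f\<close>.\<close>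

lemma lp_sum_representation:
  fixes \<phi> :: "'a::euclidean_space \<Rightarrow> real" and u :: "int \<Rightarrow> 'a \<Rightarrow> complex"
  assumes conv: "lp_sum_converges \<phi> f"
    and u: "\<And>j. represents (u j) (dyadic_block \<phi> j f)"
    and q: "\<And>j. 1 \<le> q j" and N: "\<And>j. 0 \<le> N j" "\<And>j. lebesgue_norm (q j) (u j) \<le> ennreal (N j)"
    and fin: "(\<integral>\<^sup>+j. ennreal (N j) \<partial>count_space UNIV) < \<infinity>"
  obtains g where "represents g f"
    "AE x in lborel. ennreal (norm (g x)) \<le> (\<integral>\<^sup>+j. ennreal (norm (u j x)) \<partial>count_space UNIV)"
proof -
  have [measurable]: "u j \<in> borel_measurable borel" for j
    using u[of j] by (simp add: represents_def)
  define S where "S x = (\<integral>\<^sup>+j. ennreal (norm (u j x)) \<partial>count_space UNIV)" for x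
  \<comment> \<open>Enumerating the integers gives a series over the naturals, from which
    measurability of \<open>S\<close> follows.\<close>
  have S_eq: "S x = (\<Sum>n. ennreal (norm (u (int_decode n) x)))" for x
    unfolding S_def
    by (subst nn_integral_bij_count_space[OF bij_int_decode, symmetric]) (rule nn_integral_count_space_nat)
  have [measurable]: "S \<in> borel_measurable borel"
    unfolding S_eq[abs_def] by measurable
  have S_decay: "(\<integral>\<^sup>+x. S x * ennreal (decay x) \<partial>lborel) < \<infinity>"
  proof -
    obtain C where C: "C \<ge> 0"
      "\<And>q N (u :: 'a \<Rightarrow> complex). \<lbrakk>u \<in> borel_measurable borel; 1 \<le> q; 0 \<le> N; lebesgue_norm q u \<le> ennreal N\<rbrakk> \<Longrightarrow>
        (\<integral>\<^sup>+x. ennreal (norm (u x)) * ennreal (decay x) \<partial>lborel) \<le> ennreal (C * N)"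
      using nn_integral_decay_weight_le[where 'a='a] by blast
    have "(\<integral>\<^sup>+x. S x * ennreal (decay x) \<partial>lborel) =
        (\<integral>\<^sup>+x. (\<integral>\<^sup>+j. ennreal (norm (u j x)) * ennreal (decay x) \<partial>count_space UNIV) \<partial>lborel)"
      unfolding S_def by (simp add: nn_integral_multc)
    also have "\<dots> = (\<integral>\<^sup>+j. (\<integral>\<^sup>+x. ennreal (norm (u j x)) * ennreal (decay x) \<partial>lborel) \<partial>count_space UNIV)"
      by (rule nn_integral_count_space_nn_integral) auto
    also have "\<dots> \<le> (\<integral>\<^sup>+j. ennreal C * ennreal (N j) \<partial>count_space UNIV)"
    proof (rule nn_integral_mono)
      fix j
      show "(\<integral>\<^sup>+x. ennreal (norm (u j x)) * ennreal (decay x) \<partial>lborel) \<le> ennreal C * ennreal (N j)"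
        using C(2)[OF _ q N, of j] C(1) N(1)[of j] by (simp add: ennreal_mult)
    qed
    also have "\<dots> = ennreal C * (\<integral>\<^sup>+j. ennreal (N j) \<partial>count_space UNIV)"
      by (simp add: nn_integral_cmult)
    also have "\<dots> < \<infinity>" using fin by (simp add: ennreal_mult_less_top)
    finally show ?thesis .
  qed
  have S_fin: "AE x in lborel. S x < \<infinity>"
  proof -
    have "AE x in lborel. S x * ennreal (decay x) \<noteq> \<infinity>"
      using S_decay by (intro nn_integral_PInf_AE) auto
    then show ?thesis
    proof eventually_elim
      case (elim x)
      then show ?case using decay_pos[of x] by (auto simp: ennreal_mult_eq_top_iff top.not_eq_extremum)
    qed
  qed
  define s where "s n x = (\<Sum>j\<in>{- int n..int n}. u j x)" for n x
  have [measurable]: "s n \<in> borel_measurable borel" for n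
    unfolding s_def by measurable
  \<comment> \<open>Defined by \<open>lim\<close>, \<open>g\<close> is measurable at once; its
    values where \<open>S\<close> is infinite concern a null set only.\<close>
  define g where "g x = lim (\<lambda>n. s n x)" for x
  have [measurable]: "g \<in> borel_measurable borel"
    unfolding g_def by (rule borel_measurable_lim_metric) simp
  have g: "(\<lambda>n. s n x) \<longlonglongrightarrow> g x \<and> ennreal (norm (g x)) \<le> S x" if "S x < \<infinity>" for x
  proof -
    have "integrable (count_space UNIV) (\<lambda>j. u j x)"
      using that unfolding S_def by (intro integrableI_bounded) auto
    moreover from symmetric_sums_tendsto[OF this]
    have "(\<lambda>n. s n x) \<longlonglongrightarrow> (LINT j|count_space UNIV. u j x)" by (simp add: s_def)
    moreover from this have "g x = (LINT j|count_space UNIV. u j x)" unfolding g_def by (rule limI)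
    ultimately show ?thesis using integral_norm_bound_ennreal by (auto simp: S_def)
  qed
  have s_le: "ennreal (norm (s n x)) \<le> S x" for n x
  proof -
    have "ennreal (norm (s n x)) \<le> ennreal (\<Sum>j\<in>{- int n..int n}. norm (u j x))"
      unfolding s_def by (intro ennreal_leI norm_sum)
    also have "\<dots> = (\<Sum>j\<in>{- int n..int n}. ennreal (norm (u j x)))" by simp
    also have "\<dots> \<le> S x" unfolding S_def by (rule sum_le_nn_integral_count_space) simp
    finally show ?thesis .
  qed
  have "represents g f"
    unfolding represents_def
  proof (intro conjI allI impI)
    fix \<eta> :: "'a \<Rightarrow> complex" assume \<eta>: "schwartz \<eta>"
    have [measurable]: "\<eta> \<in> borel_measurable borel" by (rule schwartz_borel_measurable[OF \<eta>])
    obtain C where C: "C \<ge> 0" "\<And>x. norm (\<eta> x) \<le> C * decay x" using schwartz_decay[OF \<eta>] by blast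
    define w where "w x = C * enn2real (S x * ennreal (decay x))" for x
    have w: "integrable lborel w" unfolding w_def
    proof (intro integrable_mult_right integrableI_nonneg)
      have "(\<integral>\<^sup>+x. ennreal (enn2real (S x * ennreal (decay x))) \<partial>lborel) \<le> (\<integral>\<^sup>+x. S x * ennreal (decay x) \<partial>lborel)"
        by (intro nn_integral_mono) (simp add: ennreal_enn2real_if)
      then show "(\<integral>\<^sup>+x. ennreal (enn2real (S x * ennreal (decay x))) \<partial>lborel) < \<infinity>"
        using S_decay by (rule le_less_trans)
    qed auto
    have lim: "AE x in lborel. (\<lambda>n. s n x * \<eta> x) \<longlonglongrightarrow> g x * \<eta> x"
      using S_fin by eventually_elim (intro tendsto_mult tendsto_const, use g in blast)
    have dom: "AE x in lborel. norm (s n x * \<eta> x) \<le> w x" for n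
      using S_fin
    proof eventually_elim
      case (elim x)
      then obtain t where t: "S x = ennreal t" "t \<ge> 0" by (cases "S x") auto
      have "norm (s n x) \<le> t" using s_le[of n x] t by (simp add: ennreal_le_iff)
      then have "norm (s n x) * norm (\<eta> x) \<le> t * (C * decay x)"
        using C t by (intro mult_mono) auto
      also have "\<dots> = w x"
        using t less_imp_le[OF decay_pos[of x]] by (simp add: w_def ennreal_mult[symmetric])
      finally show ?case by (simp add: norm_mult)
    qed
    show "integrable lborel (\<lambda>x. g x * \<eta> x)"
      by (rule integrable_dominated_convergence[OF _ _ w lim dom]) auto
    have "(\<lambda>n. LINT x|lborel. s n x * \<eta> x) \<longlonglongrightarrow> (LINT x|lborel. g x * \<eta> x)"
      by (rule integral_dominated_convergence[OF _ _ w lim dom]) auto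
    moreover have "(LINT x|lborel. s n x * \<eta> x) = (\<Sum>j\<in>{- int n..int n}. dyadic_block \<phi> j f \<eta>)" for n
      using u \<eta> by (simp add: s_def sum_distrib_right represents_def)
    moreover have "(\<lambda>n. \<Sum>j\<in>{- int n..int n}. dyadic_block \<phi> j f \<eta>) \<longlonglongrightarrow> f \<eta>"
    proof -
      \<comment> \<open>Both ends of the series tend to infinity independently in
        \<open>lp_sum_converges\<close>, in particular along the diagonal.\<close>
      have "filterlim (\<lambda>n::nat. (n, n)) (sequentially \<times>\<^sub>F sequentially) sequentially"
        by (intro filterlim_Pair filterlim_ident)
      from filterlim_compose[OF _ this] conv \<eta> show ?thesis
        unfolding lp_sum_converges_def by fastforce
    qed
    ultimately show "f \<eta> = (LINT x|lborel. g x * \<eta> x)" using LIMSEQ_unique by auto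
  qed simp
  moreover have "AE x in lborel. ennreal (norm (g x)) \<le> (\<integral>\<^sup>+j. ennreal (norm (u j x)) \<partial>count_space UNIV)"
    using S_fin by eventually_elim (use g in \<open>simp add: S_def\<close>)
  ultimately show ?thesis by (rule that)
qed

section \<open>Weighted sequences\<close>

text \<open>A substitute for the tail sum \<open>\<Sum>k. 2 powr (- \<alpha> * k) * a (J + k)\<close>: half of the exponent is spent on
  summing the geometric series, and a supremum is easier than a sum to raise to the power \<open>r\<close>.\<close>

definition discounted_sup :: "real \<Rightarrow> (int \<Rightarrow> real) \<Rightarrow> int \<Rightarrow> real" where
  "discounted_sup \<alpha> a J = (SUP k::nat. 2 powr (- (\<alpha> / 2) * real k) * a (J + int k))"

context
  fixes \<alpha> A :: real and a :: "int \<Rightarrow> real"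
  assumes \<alpha>: "\<alpha> > 0" and a_nonneg: "\<And>j. 0 \<le> a j" and a_le: "\<And>j. a j \<le> A"
begin

lemma discounted_term_le: "2 powr (- (\<alpha> / 2) * real k) * a j \<le> A"
proof -
  have "2 powr (- (\<alpha> / 2) * real k) \<le> 2 powr 0"
    using \<alpha> by (intro powr_mono) auto
  then have "2 powr (- (\<alpha> / 2) * real k) * a j \<le> 1 * a j"
    using a_nonneg by (intro mult_right_mono) auto
  then show ?thesis using a_le[of j] by simp
qed

lemma discounted_sup_upper: "2 powr (- (\<alpha> / 2) * real k) * a (J + int k) \<le> discounted_sup \<alpha> a J"
  unfolding discounted_sup_def
  by (rule cSUP_upper[OF UNIV_I bdd_aboveI2]) (rule discounted_term_le)

lemma discounted_sup_le: "discounted_sup \<alpha> a J \<le> A"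
  unfolding discounted_sup_def by (rule cSUP_least[OF UNIV_not_empty]) (rule discounted_term_le)

lemma discounted_sup_nonneg: "0 \<le> discounted_sup \<alpha> a J"
  using discounted_sup_upper[of 0 J] a_nonneg[of J] by simp

text \<open>The constant is the sum of the geometric series of ratio
  \<open>2 powr (- (\<alpha> / 2))\<close>; the other half of the decay sits in the
  supremum.\<close>

lemma tail_sum_le_discounted_sup:
  "(\<integral>\<^sup>+j. ennreal (2 powr (- \<alpha> * of_int j) * a j) \<partial>count_space {J..}) \<le>
    ennreal (1 / (1 - 2 powr (- (\<alpha> / 2))) * (2 powr (- \<alpha> * of_int J) * discounted_sup \<alpha> a J))"
proof -
  define D where "D = 2 powr (- \<alpha> * of_int J) * discounted_sup \<alpha> a J"
  define \<rho> where "\<rho> = 2 powr (- (\<alpha> / 2))"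
  have \<rho>: "0 < \<rho>" "\<rho> < 1" using \<alpha> powr_less_mono[of "- (\<alpha> / 2)" 0 2] by (auto simp: \<rho>_def)
  have D: "0 \<le> D" using discounted_sup_nonneg by (simp add: D_def)
  have bij: "bij_betw (\<lambda>k. J + int k) UNIV {J..}"
    by (rule bij_betwI[where g = "\<lambda>j. nat (j - J)"]) auto
  have "(\<integral>\<^sup>+j. ennreal (2 powr (- \<alpha> * of_int j) * a j) \<partial>count_space {J..}) =
      (\<integral>\<^sup>+k. ennreal (2 powr (- \<alpha> * of_int (J + int k)) * a (J + int k)) \<partial>count_space UNIV)"
    by (rule nn_integral_bij_count_space[OF bij, symmetric])
  also have "\<dots> \<le> (\<integral>\<^sup>+k. ennreal (\<rho> ^ k * D) \<partial>count_space UNIV)"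
  proof (intro nn_integral_mono ennreal_leI)
    fix k
    have "2 powr (- \<alpha> * of_int (J + int k)) * a (J + int k) =
        2 powr (- \<alpha> * of_int J) * \<rho> ^ k * (2 powr (- (\<alpha> / 2) * real k) * a (J + int k))"
      by (simp add: \<rho>_def powr_realpow[symmetric] powr_powr powr_add[symmetric] algebra_simps)
    also have "\<dots> \<le> 2 powr (- \<alpha> * of_int J) * \<rho> ^ k * discounted_sup \<alpha> a J"
      using \<rho> by (intro mult_left_mono discounted_sup_upper) auto
    finally show "2 powr (- \<alpha> * of_int (J + int k)) * a (J + int k) \<le> \<rho> ^ k * D"
      by (simp add: D_def mult_ac)
  qed
  also have "\<dots> = (\<Sum>k. ennreal (\<rho> ^ k * D))" by (rule nn_integral_count_space_nat)
  also have "\<dots> = ennreal (\<Sum>k. \<rho> ^ k * D)"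
    using \<rho> D by (intro suminf_ennreal2 summable_mult2 summable_geometric) auto
  also have "(\<Sum>k. \<rho> ^ k * D) = 1 / (1 - \<rho>) * D"
    using \<rho> by (subst suminf_mult2[symmetric]) (auto simp: suminf_geometric summable_geometric)
  finally show ?thesis unfolding D_def \<rho>_def .
qed

text \<open>Every term under the supremum is at most the \<open>R\<close>-th root of the sum of all
  \<open>R\<close>-th powers.\<close>

lemma discounted_sup_powr_le:
  assumes "R > 0"
  shows "ennreal (discounted_sup \<alpha> a J powr R) \<le>
    (\<integral>\<^sup>+k. ennreal ((2 powr (- (\<alpha> / 2) * real k) * a (J + int k)) powr R) \<partial>count_space UNIV)" (is "_ \<le> ?T")
proof (cases ?T)
  case (real t)
  have "discounted_sup \<alpha> a J \<le> t powr (1 / R)"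
    unfolding discounted_sup_def
  proof (rule cSUP_least)
    fix k :: nat
    let ?x = "2 powr (- (\<alpha> / 2) * real k) * a (J + int k)"
    have "ennreal (?x powr R) \<le> ?T"
      using sum_le_nn_integral_count_space[of "{k}" "\<lambda>k. ennreal ((2 powr (- (\<alpha> / 2) * real k) * a (J + int k)) powr R)"] by simp
    then have "?x powr R \<le> t" using real by (simp only: ennreal_le_iff)
    then have "(?x powr R) powr (1 / R) \<le> t powr (1 / R)" using assms by (intro powr_mono2) auto
    then show "?x \<le> t powr (1 / R)" using assms a_nonneg by (simp add: powr_powr)
  qed simp
  then have "discounted_sup \<alpha> a J powr R \<le> (t powr (1 / R)) powr R"
    using assms discounted_sup_nonneg by (intro powr_mono2) auto
  then show ?thesis using assms real by (simp add: powr_powr ennreal_leI)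
qed simp

text \<open>Once the supremum is replaced by a sum over \<open>k\<close>, Tonelli and the
  translation invariance of sums over the integers leave a geometric series of ratio
  \<open>2 powr (- (\<alpha> / 2) * R)\<close>.\<close>

lemma sum_discounted_sup_powr_le:
  assumes "R > 0"
  shows "(\<integral>\<^sup>+J. ennreal (discounted_sup \<alpha> a J powr R) \<partial>count_space UNIV) \<le>
    ennreal (1 / (1 - 2 powr (- (\<alpha> / 2) * R))) * (\<integral>\<^sup>+j. ennreal (a j powr R) \<partial>count_space UNIV)"
proof -
  define \<rho> where "\<rho> = 2 powr (- (\<alpha> / 2) * R)"
  have \<rho>: "0 < \<rho>" "\<rho> < 1" using \<alpha> assms powr_less_mono[of "- (\<alpha> / 2) * R" 0 2] by (auto simp: \<rho>_def)
  have "(\<integral>\<^sup>+J. ennreal (discounted_sup \<alpha> a J powr R) \<partial>count_space UNIV) \<le>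
      (\<integral>\<^sup>+J. (\<integral>\<^sup>+k. ennreal ((2 powr (- (\<alpha> / 2) * real k) * a (J + int k)) powr R) \<partial>count_space UNIV) \<partial>count_space UNIV)"
    by (intro nn_integral_mono discounted_sup_powr_le assms)
  also have "\<dots> = (\<integral>\<^sup>+k. (\<integral>\<^sup>+J. ennreal ((2 powr (- (\<alpha> / 2) * real k) * a (J + int k)) powr R) \<partial>count_space UNIV) \<partial>count_space UNIV)"
    by (rule nn_integral_count_space_nn_integral) auto
  also have "\<dots> = (\<integral>\<^sup>+k. ennreal (\<rho> ^ k) * (\<integral>\<^sup>+J. ennreal (a (J + int k) powr R) \<partial>count_space UNIV) \<partial>count_space UNIV)"
  proof (rule nn_integral_cong)
    fix k :: nat
    have "ennreal ((2 powr (- (\<alpha> / 2) * real k) * a (J + int k)) powr R) = ennreal (\<rho> ^ k) * ennreal (a (J + int k) powr R)" for J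
      using a_nonneg by (simp add: \<rho>_def powr_mult powr_realpow[symmetric] powr_powr ennreal_mult[symmetric] mult_ac)
    then show "(\<integral>\<^sup>+J. ennreal ((2 powr (- (\<alpha> / 2) * real k) * a (J + int k)) powr R) \<partial>count_space UNIV) =
        ennreal (\<rho> ^ k) * (\<integral>\<^sup>+J. ennreal (a (J + int k) powr R) \<partial>count_space UNIV)"
      by (simp add: nn_integral_cmult)
  qed
  also have "\<dots> = (\<integral>\<^sup>+k. ennreal (\<rho> ^ k) * (\<integral>\<^sup>+j. ennreal (a j powr R) \<partial>count_space UNIV) \<partial>count_space UNIV)"
  proof (rule nn_integral_cong)
    fix k :: nat
    have "bij (\<lambda>J. J + int k)" by (rule bij_betwI[where g = "\<lambda>J. J - int k"]) auto
    from nn_integral_bij_count_space[OF this, of "\<lambda>j. ennreal (a j powr R)"]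
    show "ennreal (\<rho> ^ k) * (\<integral>\<^sup>+J. ennreal (a (J + int k) powr R) \<partial>count_space UNIV) =
        ennreal (\<rho> ^ k) * (\<integral>\<^sup>+j. ennreal (a j powr R) \<partial>count_space UNIV)" by simp
  qed
  also have "\<dots> = (\<integral>\<^sup>+k. ennreal (\<rho> ^ k) \<partial>count_space UNIV) * (\<integral>\<^sup>+j. ennreal (a j powr R) \<partial>count_space UNIV)"
    by (rule nn_integral_multc) simp
  also have "(\<integral>\<^sup>+k. ennreal (\<rho> ^ k) \<partial>count_space UNIV) = ennreal (1 / (1 - \<rho>))"
    using \<rho> by (simp add: nn_integral_count_space_nat suminf_ennreal2 summable_geometric suminf_geometric)
  finally show ?thesis unfolding \<rho>_def .
qed

end

text \<open>Where \<open>G \<le> F\<close> at \<open>J\<close> changes to \<open>F < G\<close> at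
  \<open>J + 1\<close>, the sum is at most twice the larger term at either index. Without such a
  change, either \<open>G \<le> F\<close> from some index on or \<open>F < G\<close> everywhere;
  then \<open>H\<close> is at most twice a quantity tending to 0.\<close>

lemma exists_crossing:
  fixes F G :: "int \<Rightarrow> real"
  assumes "\<And>J. H \<le> F J + G J"
    and F: "(F \<longlongrightarrow> 0) at_top" and G: "(G \<longlongrightarrow> 0) at_bot"
  shows "H \<le> 0 \<or> (\<exists>J. H \<le> 2 * F J \<and> H \<le> 2 * G (J + 1))"
proof (cases "\<exists>J. G J \<le> F J \<and> F (J + 1) < G (J + 1)")
  case True
  then obtain J where J: "G J \<le> F J" "F (J + 1) < G (J + 1)" by blast
  have "H \<le> 2 * F J" using assms(1)[of J] J(1) by simp
  moreover have "H \<le> 2 * G (J + 1)" using assms(1)[of "J + 1"] J(2) by simp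
  ultimately show ?thesis by blast
next
  case False
  show ?thesis
  proof (cases "\<exists>I. G I \<le> F I")
    case True
    then obtain I where I: "G I \<le> F I" by blast
    have "G J \<le> F J" if "J \<ge> I" for J
      using that by (induction J rule: int_ge_induct) (use I False in \<open>auto simp: not_less\<close>)
    then have "eventually (\<lambda>J. H \<le> 2 * F J) at_top"
      using assms(1) by (intro eventually_at_top_linorderI[of I]) (smt (verit))
    moreover have "((\<lambda>J. 2 * F J) \<longlongrightarrow> 2 * 0) at_top" by (intro tendsto_intros F)
    ultimately have "H \<le> 2 * 0" by (intro tendsto_lowerbound) auto
    then show ?thesis by simp
  next
    case False
    then have "eventually (\<lambda>J. H \<le> 2 * G J) at_bot"
      using assms(1) by (intro always_eventually) (smt (verit))
    moreover have "((\<lambda>J. 2 * G J) \<longlongrightarrow> 2 * 0) at_bot" by (intro tendsto_intros G)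
    ultimately have "H \<le> 2 * 0" by (intro tendsto_lowerbound) auto
    then show ?thesis by simp
  qed
qed

text \<open>Split at the point \<open>t\<close> where the two terms agree. Below it the term with
  the positive power of \<open>s\<close> is integrable, above it the one with the negative power;
  the two pieces are \<open>?V powr r\<close> divided by \<open>c\<^sub>1 * r\<close> and by
  \<open>c\<^sub>0 * r\<close>.\<close>

lemma nn_integral_min_powr_le:
  fixes c\<^sub>0 c\<^sub>1 r P Q :: real
  assumes c: "c\<^sub>0 > 0" "c\<^sub>1 > 0" and r: "r > 0" and PQ: "P \<ge> 0" "Q \<ge> 0"
  shows "(\<integral>\<^sup>+s\<in>{0<..}. ennreal (min (s powr - c\<^sub>0 * P) (s powr c\<^sub>1 * Q) powr r * (1 / s)) \<partial>lborel) \<le>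
    ennreal ((1 / (c\<^sub>0 * r) + 1 / (c\<^sub>1 * r)) * (P powr (c\<^sub>1 / (c\<^sub>0 + c\<^sub>1)) * Q powr (c\<^sub>0 / (c\<^sub>0 + c\<^sub>1))) powr r)"
    (is "?I \<le> ennreal (_ * ?V powr r)")
proof (cases "P = 0 \<or> Q = 0")
  case True
  then have "min (s powr - c\<^sub>0 * P) (s powr c\<^sub>1 * Q) = 0" for s
    using PQ by auto
  then show ?thesis by simp
next
  case False
  then have P: "P > 0" and Q: "Q > 0" using PQ by auto
  \<comment> \<open>Solution of \<open>t powr - c\<^sub>0 * P = t powr c\<^sub>1 * Q\<close>; the
    common value is \<open>?V\<close>.\<close>
  define t where "t = (P / Q) powr (1 / (c\<^sub>0 + c\<^sub>1))"
  have t: "t > 0" using P Q by (simp add: t_def)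
  have V0: "t powr (c\<^sub>1 * r) * Q powr r = ?V powr r"
  proof -
    have "t powr c\<^sub>1 * Q = P powr (c\<^sub>1 / (c\<^sub>0 + c\<^sub>1)) * Q powr (1 - c\<^sub>1 / (c\<^sub>0 + c\<^sub>1))"
      using P Q by (simp add: t_def powr_powr powr_divide powr_diff)
    also have "1 - c\<^sub>1 / (c\<^sub>0 + c\<^sub>1) = c\<^sub>0 / (c\<^sub>0 + c\<^sub>1)" using c by (simp add: field_simps)
    finally have "t powr c\<^sub>1 * Q = ?V" .
    moreover have "t powr (c\<^sub>1 * r) * Q powr r = (t powr c\<^sub>1 * Q) powr r"
      using Q by (simp add: powr_mult powr_powr)
    ultimately show ?thesis by (simp only:)
  qed
  have V1: "t powr (- c\<^sub>0 * r) * P powr r = ?V powr r"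
  proof -
    have "t powr - c\<^sub>0 * P = P powr (1 - c\<^sub>0 / (c\<^sub>0 + c\<^sub>1)) * Q powr (c\<^sub>0 / (c\<^sub>0 + c\<^sub>1))"
      using P Q by (simp add: t_def powr_powr powr_divide powr_diff powr_minus field_simps)
    also have "1 - c\<^sub>0 / (c\<^sub>0 + c\<^sub>1) = c\<^sub>1 / (c\<^sub>0 + c\<^sub>1)" using c by (simp add: field_simps)
    finally have "t powr - c\<^sub>0 * P = ?V" .
    moreover have "t powr (- c\<^sub>0 * r) * P powr r = (t powr - c\<^sub>0 * P) powr r"
      using P by (simp add: powr_mult powr_powr)
    ultimately show ?thesis by (simp only:)
  qed
  have "?I \<le> (\<integral>\<^sup>+s. ennreal (Q powr r) * ennreal (indicator {0..t} s * s powr (c\<^sub>1 * r - 1)) +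
      ennreal (P powr r) * ennreal (indicator {t..} s * s powr (- c\<^sub>0 * r - 1)) \<partial>lborel)"
  proof (rule nn_integral_mono)
    fix s :: real
    show "ennreal (min (s powr - c\<^sub>0 * P) (s powr c\<^sub>1 * Q) powr r * (1 / s)) * indicator {0<..} s \<le>
        ennreal (Q powr r) * ennreal (indicator {0..t} s * s powr (c\<^sub>1 * r - 1)) +
        ennreal (P powr r) * ennreal (indicator {t..} s * s powr (- c\<^sub>0 * r - 1))"
    proof (cases "s > 0")
      case s: True
      let ?m = "min (s powr - c\<^sub>0 * P) (s powr c\<^sub>1 * Q) powr r * (1 / s)"
      have "?m \<le> (s powr c\<^sub>1 * Q) powr r * (1 / s)" "?m \<le> (s powr - c\<^sub>0 * P) powr r * (1 / s)"
        using s P Q r by (auto intro!: divide_right_mono powr_mono2)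
      moreover have "(s powr c\<^sub>1 * Q) powr r * (1 / s) = Q powr r * s powr (c\<^sub>1 * r - 1)"
        "(s powr - c\<^sub>0 * P) powr r * (1 / s) = P powr r * s powr (- c\<^sub>0 * r - 1)"
        using s P Q by (simp_all add: powr_mult powr_powr powr_diff)
      ultimately have m: "ennreal ?m \<le> ennreal (Q powr r) * ennreal (s powr (c\<^sub>1 * r - 1))"
        "ennreal ?m \<le> ennreal (P powr r) * ennreal (s powr (- c\<^sub>0 * r - 1))"
        by (simp_all add: ennreal_mult[symmetric] ennreal_leI)
      show ?thesis
      proof (cases "s \<le> t")
        case True
        then show ?thesis using s m(1) by (intro add_increasing2) auto
      next
        case False
        then show ?thesis using s m(2) by (intro add_increasing) auto
      qed
    qed simp
  qed
  also have "\<dots> = ennreal (Q powr r) * (\<integral>\<^sup>+s. ennreal (indicator {0..t} s * s powr (c\<^sub>1 * r - 1)) \<partial>lborel) +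
      ennreal (P powr r) * (\<integral>\<^sup>+s. ennreal (indicator {t..} s * s powr (- c\<^sub>0 * r - 1)) \<partial>lborel)"
    by (subst nn_integral_add, measurable, subst (1 2) nn_integral_cmult, measurable)
  also have "(\<integral>\<^sup>+s. ennreal (indicator {0..t} s * s powr (c\<^sub>1 * r - 1)) \<partial>lborel) =
      ennreal (t powr (c\<^sub>1 * r - 1 + 1) / (c\<^sub>1 * r - 1 + 1))"
    by (rule nn_integral_has_integral_lebesgue[OF _ has_integral_powr_from_0]) (use t c r in auto)
  also have "(\<integral>\<^sup>+s. ennreal (indicator {t..} s * s powr (- c\<^sub>0 * r - 1)) \<partial>lborel) =
      ennreal (- (t powr (- c\<^sub>0 * r - 1 + 1)) / (- c\<^sub>0 * r - 1 + 1))"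
    by (rule nn_integral_has_integral_lebesgue[OF _ has_integral_powr_to_inf]) (use t c r in auto)
  also have "ennreal (Q powr r) * ennreal (t powr (c\<^sub>1 * r - 1 + 1) / (c\<^sub>1 * r - 1 + 1)) +
      ennreal (P powr r) * ennreal (- (t powr (- c\<^sub>0 * r - 1 + 1)) / (- c\<^sub>0 * r - 1 + 1)) =
      ennreal (t powr (c\<^sub>1 * r) * Q powr r / (c\<^sub>1 * r) + t powr (- c\<^sub>0 * r) * P powr r / (c\<^sub>0 * r))"
    using c r by (subst ennreal_plus) (simp_all add: ennreal_mult[symmetric] mult.commute)
  also have "t powr (c\<^sub>1 * r) * Q powr r / (c\<^sub>1 * r) + t powr (- c\<^sub>0 * r) * P powr r / (c\<^sub>0 * r) =
      (1 / (c\<^sub>0 * r) + 1 / (c\<^sub>1 * r)) * ?V powr r"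
    unfolding V0 V1 by (simp add: algebra_simps)
  finally show ?thesis .
qed

text \<open>A weak form of Young's inequality, obtained by replacing both bases by their
  maximum.\<close>

lemma powr_mult_powr_le_add:
  fixes u v \<kappa> \<mu> :: real
  assumes "u \<ge> 0" "v \<ge> 0" "\<kappa> \<ge> 0" "\<mu> \<ge> 0" "\<kappa> + \<mu> = 1"
  shows "u powr \<kappa> * v powr \<mu> \<le> u + v"
proof -
  have "u powr \<kappa> * v powr \<mu> \<le> max u v powr \<kappa> * max u v powr \<mu>"
    using assms by (intro mult_mono powr_mono2) auto
  also have "\<dots> = max u v" using assms by (simp add: powr_add[symmetric])
  also have "\<dots> \<le> u + v" using assms by simp
  finally show ?thesis .
qed

text \<open>The bound \<open>a j \<le> A\<close> is the whole condition for \<open>R = \<infinity>\<close>, and a consequence of the other one for \<open>R < \<infinity>\<close>.\<close>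

definition seq_norm_le :: "ennreal \<Rightarrow> (int \<Rightarrow> real) \<Rightarrow> real \<Rightarrow> bool" where
  "seq_norm_le R a A \<longleftrightarrow> (\<forall>j. 0 \<le> a j \<and> a j \<le> A) \<and>
     (R < \<infinity> \<longrightarrow> (\<integral>\<^sup>+j. ennreal (a j powr enn2real R) \<partial>count_space UNIV) \<le> ennreal (A powr enn2real R))"

text \<open>Here \<open>\<rho>\<close> is the reciprocal of the second exponent, and
  \<open>\<rho> = 0\<close> stands for the supremum norm. After division by \<open>A\<close> and
  \<open>B\<close>, Young's inequality applies term by term, because
  \<open>(1 - \<theta>) * r / R\<^sub>0\<close> and \<open>\<theta> * r * \<rho>\<close> add up to
  1.\<close>

lemma sum_interpolated_powr_le:
  fixes x y :: "int \<Rightarrow> real"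
  assumes \<theta>: "0 < \<theta>" "\<theta> < 1" and r: "r > 0" "R\<^sub>0 > 0" "\<rho> \<ge> 0" "1 / r = (1 - \<theta>) / R\<^sub>0 + \<theta> * \<rho>"
    and x: "\<And>J. 0 \<le> x J" "\<And>J. x J \<le> A" and y: "\<And>J. 0 \<le> y J" "\<And>J. y J \<le> B"
    and K: "K\<^sub>0 \<ge> 0" "K\<^sub>1 \<ge> 0"
    and x_sum: "(\<integral>\<^sup>+J. ennreal (x J powr R\<^sub>0) \<partial>count_space UNIV) \<le> ennreal (K\<^sub>0 * A powr R\<^sub>0)"
    and y_sum: "\<rho> > 0 \<Longrightarrow> (\<integral>\<^sup>+J. ennreal (y J powr (1 / \<rho>)) \<partial>count_space UNIV) \<le> ennreal (K\<^sub>1 * B powr (1 / \<rho>))"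
  shows "(\<integral>\<^sup>+J. ennreal ((x J powr (1 - \<theta>) * y J powr \<theta>) powr r) \<partial>count_space UNIV) \<le>
    ennreal ((K\<^sub>0 + K\<^sub>1) * (A powr (1 - \<theta>) * B powr \<theta>) powr r)"
proof (cases "A = 0 \<or> B = 0")
  \<comment> \<open>No division by \<open>A\<close> and \<open>B\<close> is possible here, but every
    product vanishes.\<close>
  case True
  then have "x J = 0 \<or> y J = 0" for J
    using x[of J] y[of J] by linarith
  then have zero: "(x J powr (1 - \<theta>) * y J powr \<theta>) powr r = 0" for J
    by (metis mult_zero_left mult_zero_right powr_0)
  show ?thesis unfolding zero by simp
next
  case False
  then have A: "A > 0" and B: "B > 0" using x[of 0] y[of 0] by linarith+
  have one: "(1 - \<theta>) * r / R\<^sub>0 + \<theta> * r * \<rho> = 1"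
    using r by (simp add: field_simps)
  define M where "M = (A powr (1 - \<theta>) * B powr \<theta>) powr r"
  define Y where "Y J = (if \<rho> > 0 then (y J / B) powr (1 / \<rho>) else 0)" for J
  have "(x J powr (1 - \<theta>) * y J powr \<theta>) powr r \<le> M * ((x J / A) powr R\<^sub>0 + Y J)" for J
  proof -
    have "(x J powr (1 - \<theta>) * y J powr \<theta>) powr r = M * ((x J / A) powr ((1 - \<theta>) * r) * (y J / B) powr (\<theta> * r))"
      using x[of J] y[of J] A B by (simp add: M_def powr_mult powr_divide powr_powr)
    also have "(x J / A) powr ((1 - \<theta>) * r) * (y J / B) powr (\<theta> * r) \<le> (x J / A) powr R\<^sub>0 + Y J"
    proof (cases "\<rho> > 0")
      case True
      have "(x J / A) powr ((1 - \<theta>) * r) * (y J / B) powr (\<theta> * r) =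
          ((x J / A) powr R\<^sub>0) powr ((1 - \<theta>) * r / R\<^sub>0) * ((y J / B) powr (1 / \<rho>)) powr (\<theta> * r * \<rho>)"
        using r True by (simp add: powr_powr)
      also have "\<dots> \<le> (x J / A) powr R\<^sub>0 + (y J / B) powr (1 / \<rho>)"
        using \<theta> r one by (intro powr_mult_powr_le_add) auto
      finally show ?thesis using True by (simp add: Y_def)
    next
      case False
      \<comment> \<open>For \<open>\<rho> = 0\<close> the exponent relation leaves the first
        exponent alone, and the factor coming from \<open>y\<close> is at most 1.\<close>
      then have "(1 - \<theta>) * r = R\<^sub>0" using one r by (simp add: field_simps)
      moreover have "(y J / B) powr (\<theta> * r) \<le> 1"
        using y[of J] B \<theta> r by (intro powr_le1) auto
      ultimately show ?thesis using False mult_left_mono[of "(y J / B) powr (\<theta> * r)" 1 "(x J / A) powr R\<^sub>0"] by (simp add: Y_def)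
    qed
    finally show ?thesis by (simp add: M_def mult_left_mono)
  qed
  then have "(\<integral>\<^sup>+J. ennreal ((x J powr (1 - \<theta>) * y J powr \<theta>) powr r) \<partial>count_space UNIV) \<le>
      (\<integral>\<^sup>+J. ennreal M * (ennreal ((x J / A) powr R\<^sub>0) + ennreal (Y J)) \<partial>count_space UNIV)"
    by (intro nn_integral_mono) (simp add: M_def Y_def ennreal_plus[symmetric] ennreal_mult[symmetric] ennreal_leI del: ennreal_plus)
  also have "\<dots> = ennreal M * ((\<integral>\<^sup>+J. ennreal ((x J / A) powr R\<^sub>0) \<partial>count_space UNIV) + (\<integral>\<^sup>+J. ennreal (Y J) \<partial>count_space UNIV))"
    by (simp add: nn_integral_cmult nn_integral_add)
  also have "\<dots> \<le> ennreal M * (ennreal K\<^sub>0 + ennreal K\<^sub>1)"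
  proof (intro mult_left_mono add_mono)
    have rescale: "(\<integral>\<^sup>+J. ennreal ((z J / C) powr R) \<partial>count_space UNIV) \<le> ennreal K"
      if "(\<integral>\<^sup>+J. ennreal (z J powr R) \<partial>count_space UNIV) \<le> ennreal (K * C powr R)" "C > 0" "K \<ge> 0" "\<And>J. 0 \<le> z J"
      for z :: "int \<Rightarrow> real" and K C R
    proof -
      have "(\<integral>\<^sup>+J. ennreal ((z J / C) powr R) \<partial>count_space UNIV) =
          (\<integral>\<^sup>+J. ennreal (1 / C powr R) * ennreal (z J powr R) \<partial>count_space UNIV)"
        using that by (simp add: powr_divide ennreal_mult[symmetric])
      also have "\<dots> = ennreal (1 / C powr R) * (\<integral>\<^sup>+J. ennreal (z J powr R) \<partial>count_space UNIV)"
        by (simp add: nn_integral_cmult)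
      also have "\<dots> \<le> ennreal (1 / C powr R) * ennreal (K * C powr R)"
        by (intro mult_left_mono that) auto
      also have "\<dots> = ennreal K" using that by (simp add: ennreal_mult[symmetric])
      finally show ?thesis .
    qed
    show "(\<integral>\<^sup>+J. ennreal ((x J / A) powr R\<^sub>0) \<partial>count_space UNIV) \<le> ennreal K\<^sub>0"
      by (rule rescale[OF x_sum A K(1) x(1)])
    show "(\<integral>\<^sup>+J. ennreal (Y J) \<partial>count_space UNIV) \<le> ennreal K\<^sub>1"
      using rescale[OF y_sum B K(2) y(1)] by (cases "\<rho> > 0") (simp_all add: Y_def)
  qed auto
  also have "\<dots> = ennreal ((K\<^sub>0 + K\<^sub>1) * M)"
    using K by (simp add: M_def ennreal_plus[symmetric] ennreal_mult[symmetric] mult.commute del: ennreal_plus)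
  finally show ?thesis unfolding M_def .
qed

text \<open>The minimum is at most the geometric mean with weights \<open>1 - \<theta>\<close> and
  \<open>\<theta>\<close>, in which the powers of \<open>s\<close> cancel by the last hypothesis.
  This is the counterpart of \<open>nn_integral_min_powr_le\<close> for infinite
  \<open>r\<close>.\<close>

lemma min_powr_le:
  fixes c\<^sub>0 c\<^sub>1 \<theta> s P Q :: real
  assumes "s > 0" "P \<ge> 0" "Q \<ge> 0" "0 < \<theta>" "\<theta> < 1" "(1 - \<theta>) * c\<^sub>0 = \<theta> * c\<^sub>1"
  shows "min (s powr - c\<^sub>0 * P) (s powr c\<^sub>1 * Q) \<le> P powr (1 - \<theta>) * Q powr \<theta>"
proof -
  define m where "m = min (s powr - c\<^sub>0 * P) (s powr c\<^sub>1 * Q)"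
  have m: "m \<ge> 0" using assms by (simp add: m_def)
  then have "m = m powr (1 - \<theta>) * m powr \<theta>" by (simp add: powr_add[symmetric])
  also have "\<dots> \<le> (s powr - c\<^sub>0 * P) powr (1 - \<theta>) * (s powr c\<^sub>1 * Q) powr \<theta>"
    using assms m by (intro mult_mono powr_mono2) (auto simp: m_def)
  also have "\<dots> = (s powr (- c\<^sub>0 * (1 - \<theta>)) * s powr (c\<^sub>1 * \<theta>)) * (P powr (1 - \<theta>) * Q powr \<theta>)"
    using assms(1-3) by (simp add: powr_mult powr_powr)
  also have "s powr (- c\<^sub>0 * (1 - \<theta>)) * s powr (c\<^sub>1 * \<theta>) = s powr (- c\<^sub>0 * (1 - \<theta>) + c\<^sub>1 * \<theta>)"
    by (rule powr_add[symmetric])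
  also have "- c\<^sub>0 * (1 - \<theta>) + c\<^sub>1 * \<theta> = 0" using assms(6) by (simp add: mult.commute)
  also have "s powr 0 * (P powr (1 - \<theta>) * Q powr \<theta>) = P powr (1 - \<theta>) * Q powr \<theta>"
    using assms(1) by simp
  finally show ?thesis unfolding m_def .
qed

text \<open>In the application \<open>\<delta>\<close> is the difference of the reciprocals of
  \<open>q\<^sub>0\<close> and \<open>q\<^sub>1\<close>. The exponents
  \<open>\<theta> * \<delta>\<close> and \<open>(1 - \<theta>) * \<delta>\<close> are such that the
  bounds on the minimum produce exactly
  \<open>F J powr (1 - \<theta>) * G J powr \<theta>\<close>.\<close>

lemma lorentz_norm_le:
  fixes F G :: "int \<Rightarrow> real" and g :: "'a::euclidean_space \<Rightarrow> complex"
  assumes \<theta>: "0 < \<theta>" "\<theta> < 1" and \<delta>: "\<delta> > 0" and K: "K \<ge> 0" and FG: "\<And>J. 0 \<le> F J" "\<And>J. 0 \<le> G J"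
    and cross: "\<And>s. s > 0 \<Longrightarrow> \<exists>J. ennreal (s powr (1 / p)) * decr_rearrangement g s \<le>
      ennreal (K * min (s powr - (\<theta> * \<delta>) * F J) (s powr ((1 - \<theta>) * \<delta>) * G J))"
    and M: "M \<ge> 0" "if r = \<infinity> then \<forall>J. F J powr (1 - \<theta>) * G J powr \<theta> \<le> M
      else enn2real r > 0 \<and> (\<integral>\<^sup>+J. ennreal ((F J powr (1 - \<theta>) * G J powr \<theta>) powr enn2real r) \<partial>count_space UNIV) \<le> ennreal (M powr enn2real r)"
  shows "lorentz_norm p r g \<le> ennreal (K * (if r = \<infinity> then 1 else
      (1 / (\<theta> * \<delta> * enn2real r) + 1 / ((1 - \<theta>) * \<delta> * enn2real r)) powr (1 / enn2real r)) * M)"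
proof (cases "r = \<infinity>")
  case True
  have "ennreal (s powr (1 / p)) * decr_rearrangement g s \<le> ennreal (K * M)" if s: "s > 0" for s
  proof -
    obtain J where J: "ennreal (s powr (1 / p)) * decr_rearrangement g s \<le>
      ennreal (K * min (s powr - (\<theta> * \<delta>) * F J) (s powr ((1 - \<theta>) * \<delta>) * G J))"
      using cross[OF s] by blast
    have "min (s powr - (\<theta> * \<delta>) * F J) (s powr ((1 - \<theta>) * \<delta>) * G J) \<le> F J powr (1 - \<theta>) * G J powr \<theta>"
      using s FG \<theta> by (intro min_powr_le) auto
    also have "\<dots> \<le> M" using M(2) True by simp
    finally show ?thesis using J K by (meson ennreal_leI mult_left_mono order_trans)
  qed
  then show ?thesis using True by (auto simp: lorentz_norm_def intro!: SUP_least)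
next
  case False
  define R where "R = enn2real r"
  have R: "R > 0" and Msum: "(\<integral>\<^sup>+J. ennreal ((F J powr (1 - \<theta>) * G J powr \<theta>) powr R) \<partial>count_space UNIV) \<le> ennreal (M powr R)"
    using M(2) False by (auto simp: R_def)
  define c where "c = 1 / (\<theta> * \<delta> * R) + 1 / ((1 - \<theta>) * \<delta> * R)"
  have c: "c \<ge> 0" using \<theta> \<delta> R by (simp add: c_def)
  define m where "m s J = min (s powr - (\<theta> * \<delta>) * F J) (s powr ((1 - \<theta>) * \<delta>) * G J)" for s J
  have m: "m s J \<ge> 0" for s J using FG by (simp add: m_def)
  have m_meas [measurable]: "(\<lambda>s. m s J) \<in> borel_measurable borel" for J unfolding m_def by measurable
  \<comment> \<open>The index given by \<open>cross\<close> depends on \<open>s\<close> in an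
    uncontrolled way. Summing over all \<open>J\<close> removes the choice and permits the exchange
    with the integral.\<close>
  have "(\<integral>\<^sup>+s\<in>{0<..}. (ennreal (s powr (1 / p)) * decr_rearrangement g s) epowr R * ennreal (1 / s) \<partial>lborel) \<le>
      (\<integral>\<^sup>+s. (\<integral>\<^sup>+J. ennreal (K powr R) * (ennreal (m s J powr R * (1 / s)) * indicator {0<..} s) \<partial>count_space UNIV) \<partial>lborel)"
  proof (rule nn_integral_mono)
    fix s :: real
    show "(ennreal (s powr (1 / p)) * decr_rearrangement g s) epowr R * ennreal (1 / s) * indicator {0<..} s \<le>
      (\<integral>\<^sup>+J. ennreal (K powr R) * (ennreal (m s J powr R * (1 / s)) * indicator {0<..} s) \<partial>count_space UNIV)"
    proof (cases "s > 0")
      case True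
      obtain J where J: "ennreal (s powr (1 / p)) * decr_rearrangement g s \<le> ennreal (K * m s J)"
        using cross[OF True] by (auto simp: m_def)
      have "(ennreal (s powr (1 / p)) * decr_rearrangement g s) epowr R \<le> ennreal (K * m s J) epowr R"
        using R J by (intro epowr_mono) auto
      also have "\<dots> = ennreal (K powr R * m s J powr R)" using K m by (simp add: epowr_ennreal powr_mult)
      finally have "(ennreal (s powr (1 / p)) * decr_rearrangement g s) epowr R * ennreal (1 / s) \<le>
          ennreal (K powr R * m s J powr R) * ennreal (1 / s)" by (rule mult_right_mono) simp
      also have "\<dots> = ennreal (K powr R) * (ennreal (m s J powr R * (1 / s)))"
        using True by (simp add: ennreal_mult[symmetric])
      also have "\<dots> \<le> (\<integral>\<^sup>+J. ennreal (K powr R) * (ennreal (m s J powr R * (1 / s))) \<partial>count_space UNIV)"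
        using sum_le_nn_integral_count_space[of "{J}" "\<lambda>J. ennreal (K powr R) * (ennreal (m s J powr R * (1 / s)))"] by simp
      finally show ?thesis using True by simp
    qed simp
  qed
  also have "\<dots> = (\<integral>\<^sup>+J. (\<integral>\<^sup>+s. ennreal (K powr R) * (ennreal (m s J powr R * (1 / s)) * indicator {0<..} s) \<partial>lborel) \<partial>count_space UNIV)"
    by (rule nn_integral_count_space_nn_integral) auto
  also have "\<dots> \<le> (\<integral>\<^sup>+J. ennreal (K powr R * c) * ennreal ((F J powr (1 - \<theta>) * G J powr \<theta>) powr R) \<partial>count_space UNIV)"
  proof (rule nn_integral_mono)
    fix J
    have e: "(1 - \<theta>) * \<delta> / (\<theta> * \<delta> + (1 - \<theta>) * \<delta>) = 1 - \<theta>" "\<theta> * \<delta> / (\<theta> * \<delta> + (1 - \<theta>) * \<delta>) = \<theta>"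
      using \<delta> by (simp_all add: field_simps)
    have "(\<integral>\<^sup>+s. ennreal (K powr R) * (ennreal (m s J powr R * (1 / s)) * indicator {0<..} s) \<partial>lborel) =
        ennreal (K powr R) * (\<integral>\<^sup>+s\<in>{0<..}. ennreal (m s J powr R * (1 / s)) \<partial>lborel)"
      by (rule nn_integral_cmult) measurable
    also have "\<dots> \<le> ennreal (K powr R) * ennreal (c * (F J powr (1 - \<theta>) * G J powr \<theta>) powr R)"
      using nn_integral_min_powr_le[of "\<theta> * \<delta>" "(1 - \<theta>) * \<delta>" R "F J" "G J"] \<theta> \<delta> R FG[of J]
      unfolding e by (intro mult_left_mono) (simp_all add: m_def c_def)
    also have "\<dots> = ennreal (K powr R * c) * ennreal ((F J powr (1 - \<theta>) * G J powr \<theta>) powr R)"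
      using c by (simp add: ennreal_mult mult.assoc)
    finally show "(\<integral>\<^sup>+s. ennreal (K powr R) * (ennreal (m s J powr R * (1 / s)) * indicator {0<..} s) \<partial>lborel) \<le>
        ennreal (K powr R * c) * ennreal ((F J powr (1 - \<theta>) * G J powr \<theta>) powr R)" .
  qed
  also have "\<dots> = ennreal (K powr R * c) * (\<integral>\<^sup>+J. ennreal ((F J powr (1 - \<theta>) * G J powr \<theta>) powr R) \<partial>count_space UNIV)"
    by (simp add: nn_integral_cmult)
  also have "\<dots> \<le> ennreal (K powr R * c) * ennreal (M powr R)" by (intro mult_left_mono Msum) simp
  also have "\<dots> = ennreal (K powr R * c * M powr R)" using c by (simp add: ennreal_mult)
  finally have "lorentz_norm p r g \<le> ennreal (K powr R * c * M powr R) epowr (1 / R)"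
    using False R unfolding lorentz_norm_def R_def by (auto intro!: epowr_mono)
  also have "\<dots> = ennreal (K * c powr (1 / R) * M)"
    using c K M(1) R by (simp add: epowr_ennreal powr_mult powr_powr)
  finally show ?thesis using False by (simp add: c_def R_def)
qed

section \<open>Besov semi-norms as sequence norms\<close>

lemma ennreal_divide_recip:
  assumes "1 \<le> q" "x \<ge> 0"
  shows "ennreal x / q = ennreal (x * enn2real (1 / q))"
  using assms by (cases q) (auto simp: divide_ennreal enn2real_recip simp flip: ennreal_1)

lemma enn2real_recip_less:
  assumes "1 \<le> q\<^sub>0" "q\<^sub>0 < q\<^sub>1"
  shows "enn2real (1 / q\<^sub>1) < enn2real (1 / q\<^sub>0)"
  using assms by (cases q\<^sub>0; cases q\<^sub>1) (auto simp: divide_ennreal ennreal_less_iff frac_less2 simp flip: ennreal_1)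

text \<open>Finiteness of \<open>q\<^sub>0\<close> makes the right-hand side a positive real, so the
  relation can be read in the reals. It is applied both to \<open>p\<close> with the Lebesgue
  exponents and to \<open>r\<close> with the summation exponents.\<close>

lemma real_exponent:
  assumes q: "1 \<le> q\<^sub>0" "q\<^sub>0 < \<infinity>" "1 \<le> q\<^sub>1" and \<theta>: "0 < \<theta>" "\<theta> < 1"
    and r: "1 / r = ennreal (1 - \<theta>) / q\<^sub>0 + ennreal \<theta> / q\<^sub>1"
  shows "r < \<infinity>" and "enn2real r > 0"
    and "1 / enn2real r = (1 - \<theta>) * enn2real (1 / q\<^sub>0) + \<theta> * enn2real (1 / q\<^sub>1)"
proof -
  define e where "e = (1 - \<theta>) * enn2real (1 / q\<^sub>0) + \<theta> * enn2real (1 / q\<^sub>1)"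
  have "enn2real (1 / q\<^sub>0) > 0"
    unfolding enn2real_recip[OF q(1)] using q by (cases q\<^sub>0) (auto simp flip: ennreal_1)
  then have e: "e > 0" using \<theta> by (simp add: e_def add_pos_nonneg)
  have re: "1 / r = ennreal e"
    using q \<theta> by (simp add: r e_def ennreal_divide_recip ennreal_plus[symmetric] del: ennreal_plus)
  then have r1: "r \<noteq> \<infinity>" "r \<noteq> 0" using e by (auto simp: ennreal_divide_zero)
  then obtain R where R: "r = ennreal R" "R > 0" by (cases r) (auto simp: less_le)
  show "r < \<infinity>" "enn2real r > 0" using R by auto
  show "1 / enn2real r = (1 - \<theta>) * enn2real (1 / q\<^sub>0) + \<theta> * enn2real (1 / q\<^sub>1)"
  proof -
    have "1 / R = e" using re R e by (simp add: divide_ennreal flip: ennreal_1)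
    then show ?thesis using R by (simp add: e_def)
  qed
qed

lemma lebesgue_norm_cong_AE:
  fixes u v :: "'a::euclidean_space \<Rightarrow> complex"
  assumes [measurable]: "u \<in> borel_measurable borel" "v \<in> borel_measurable borel"
    and "AE x in lborel. u x = v x"
  shows "lebesgue_norm q u = lebesgue_norm q v"
proof -
  have "esssup lborel (\<lambda>x. ennreal (norm (u x))) = esssup lborel (\<lambda>x. ennreal (norm (v x)))"
    using assms(3) by (intro esssup_AE_cong) (auto elim: eventually_mono)
  moreover have "(\<integral>\<^sup>+x. ennreal (norm (u x)) epowr enn2real q \<partial>lborel) = (\<integral>\<^sup>+x. ennreal (norm (v x)) epowr enn2real q \<partial>lborel)"
    using assms(3) by (intro nn_integral_cong_AE) (auto elim: eventually_mono)
  ultimately show ?thesis by (simp add: lebesgue_norm_def)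
qed

text \<open>By uniqueness almost everywhere the infimum runs over a constant family. Hence one
  function represents a block for both Lebesgue exponents at once.\<close>

lemma lebesgue_norm_dist_eq:
  fixes u :: "'a::euclidean_space \<Rightarrow> complex"
  assumes "lp_cutoff (\<phi> :: 'a \<Rightarrow> real)" and u: "represents u D"
  shows "lebesgue_norm_dist q D = lebesgue_norm q u"
proof -
  have eq: "lebesgue_norm q u = lebesgue_norm q v" if v: "represents v D" for v
    using u v represents_AE_unique[OF assms(1) u v]
    by (intro lebesgue_norm_cong_AE) (auto simp: represents_def)
  show ?thesis unfolding lebesgue_norm_dist_def
  proof (rule antisym)
    show "(INF g\<in>{g. represents g D}. lebesgue_norm q g) \<le> lebesgue_norm q u"
      using u by (intro INF_lower) simp
    show "lebesgue_norm q u \<le> (INF g\<in>{g. represents g D}. lebesgue_norm q g)"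
      by (rule INF_greatest) (metis eq mem_Collect_eq order_refl)
  qed
qed

text \<open>Passes from \<open>infsum\<close> to an integral, for which Tonelli is at hand. Partial
  sums along an enumeration are finite sums, and \<open>infsum\<close> is the supremum of
  those.\<close>

lemma nn_integral_count_space_le_infsum:
  fixes f :: "int \<Rightarrow> ennreal"
  shows "(\<integral>\<^sup>+j. f j \<partial>count_space UNIV) \<le> infsum f UNIV"
proof -
  have "(\<integral>\<^sup>+j. f j \<partial>count_space UNIV) = (\<Sum>n. f (int_decode n))"
    by (subst nn_integral_bij_count_space[OF bij_int_decode, symmetric]) (rule nn_integral_count_space_nat)
  also have "\<dots> = (SUP n. \<Sum>i<n. f (int_decode i))" by (rule suminf_eq_SUP)
  also have "\<dots> \<le> infsum f UNIV"
  proof (rule SUP_least)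
    fix n
    have "(\<Sum>i<n. f (int_decode i)) = sum f (int_decode ` {..<n})"
      by (subst sum.reindex) (auto intro: inj_on_subset[OF inj_int_decode])
    also have "\<dots> \<le> (SUP F\<in>{F. finite F \<and> F \<subseteq> UNIV}. sum f F)"
      by (rule SUP_upper) auto
    also have "\<dots> = infsum f UNIV" by (rule nonneg_infsum_complete[symmetric]) simp
    finally show "(\<Sum>i<n. f (int_decode i)) \<le> infsum f UNIV" .
  qed
  finally show ?thesis .
qed

text \<open>The weights are positive, so a finite semi-norm forces finite block norms and the data
  become real sequences. For finite \<open>R\<close> the pointwise bound comes from comparing one
  term with the whole sum \<open>t\<close>, whose \<open>R\<close>-th root is
  \<open>b\<close>.\<close>

lemma besov_seminorm_finite:
  assumes R: "1 \<le> R" and fin: "besov_seminorm \<phi> \<sigma> q R f < \<infinity>"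
  obtains N where "\<And>j. 0 \<le> N j" "\<And>j. lebesgue_norm_dist q (dyadic_block \<phi> j f) = ennreal (N j)"
    "seq_norm_le R (\<lambda>j. 2 powr (of_int j * \<sigma>) * N j) (enn2real (besov_seminorm \<phi> \<sigma> q R f))"
proof -
  define L where "L j = lebesgue_norm_dist q (dyadic_block \<phi> j f)" for j
  define N where "N j = enn2real (L j)" for j
  have N: "0 \<le> N j" for j by (simp add: N_def)
  obtain b where b: "besov_seminorm \<phi> \<sigma> q R f = ennreal b" "b \<ge> 0"
    using fin by (cases "besov_seminorm \<phi> \<sigma> q R f") auto
  have "(\<forall>j. L j \<noteq> \<infinity>) \<and> seq_norm_le R (\<lambda>j. 2 powr (of_int j * \<sigma>) * N j) b"
  proof (cases "R = \<infinity>")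
    case True
    have le: "ennreal (2 powr (of_int j * \<sigma>)) * L j \<le> ennreal b" for j
      unfolding b(1)[symmetric] besov_seminorm_def L_def using True by (auto intro: SUP_upper)
    have L: "L j \<noteq> \<infinity>" for j
    proof
      assume "L j = \<infinity>"
      with le[of j] show False by (simp add: ennreal_mult_top top_unique)
    qed
    then have L_eq: "L j = ennreal (N j)" for j by (simp add: N_def ennreal_enn2real_if)
    have "2 powr (of_int j * \<sigma>) * N j \<le> b" for j
      using le[of j] b(2) N[of j] unfolding L_eq by (simp add: ennreal_mult[symmetric])
    then show ?thesis using L True N by (simp add: seq_norm_le_def)
  next
    case False
    define \<rho> where "\<rho> = enn2real R"
    have \<rho>: "\<rho> > 0" using R False by (cases R) (auto simp: \<rho>_def simp flip: ennreal_1)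
    define f' where "f' j = ennreal (2 powr (of_int j * \<sigma> * \<rho>)) * L j epowr \<rho>" for j :: int
    have b_eq: "infsum f' UNIV epowr (1 / \<rho>) = ennreal b"
      using False b(1) by (simp add: besov_seminorm_def L_def \<rho>_def f'_def[abs_def])
    then obtain t where t: "infsum f' UNIV = ennreal t" "t \<ge> 0"
      by (cases "infsum f' UNIV") (auto simp: epowr_def)
    have bt: "b = t powr (1 / \<rho>)" using b_eq b(2) t by (simp add: epowr_ennreal)
    have sum_le: "(\<integral>\<^sup>+j. f' j \<partial>count_space UNIV) \<le> ennreal t"
      using nn_integral_count_space_le_infsum[of f'] t by simp
    have le: "f' j \<le> ennreal t" for j
      using order_trans[OF sum_le_nn_integral_count_space[of "{j}" f'] sum_le] by simp
    have L: "L j \<noteq> \<infinity>" for j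
    proof
      assume "L j = \<infinity>"
      with le[of j] show False by (simp add: f'_def epowr_def ennreal_mult_top top_unique)
    qed
    then have L_eq: "L j = ennreal (N j)" for j by (simp add: N_def ennreal_enn2real_if)
    have f'_eq: "f' j = ennreal ((2 powr (of_int j * \<sigma>) * N j) powr \<rho>)" for j
      using N[of j] by (simp add: f'_def L_eq epowr_ennreal powr_mult powr_powr ennreal_mult)
    have "2 powr (of_int j * \<sigma>) * N j \<le> b" for j
    proof -
      have "(2 powr (of_int j * \<sigma>) * N j) powr \<rho> \<le> t" using le[of j] t by (simp add: f'_eq)
      then have "((2 powr (of_int j * \<sigma>) * N j) powr \<rho>) powr (1 / \<rho>) \<le> b"
        unfolding bt using \<rho> by (intro powr_mono2) auto
      then show ?thesis using \<rho> N[of j] by (simp add: powr_powr)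
    qed
    moreover have "b powr \<rho> = t" using \<rho> t by (simp add: bt powr_powr)
    ultimately show ?thesis
      using L sum_le N by (simp add: seq_norm_le_def f'_eq \<rho>_def[symmetric])
  qed
  then have L: "L j \<noteq> \<infinity>" and norm: "seq_norm_le R (\<lambda>j. 2 powr (of_int j * \<sigma>) * N j) b" for j
    by auto
  have "L j = ennreal (N j)" for j using L[of j] by (simp add: N_def ennreal_enn2real_if)
  then show ?thesis using N norm b by (intro that[of N]) (simp_all add: L_def)
qed

section \<open>The interpolation estimate\<close>

lemma bij_uminus_int: "bij (uminus :: int \<Rightarrow> int)"
  by (rule bij_betwI[where g = uminus]) auto

text \<open>Reflection turns sums over low frequencies into tails, so that the facts on
  \<open>discounted_sup\<close> serve both ends.\<close>

lemma seq_norm_le_reflect: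
  assumes "seq_norm_le R a A"
  shows "seq_norm_le R (\<lambda>j. a (- j)) A"
  using assms nn_integral_bij_count_space[OF bij_uminus_int, of "\<lambda>j. ennreal (a j powr enn2real R)"]
  by (simp add: seq_norm_le_def)

lemma sum_discounted_sup_le_seq_norm:
  assumes "\<alpha> > 0" "seq_norm_le R a A" "R < \<infinity>" "enn2real R > 0"
  shows "(\<integral>\<^sup>+J. ennreal (discounted_sup \<alpha> a J powr enn2real R) \<partial>count_space UNIV) \<le>
    ennreal (1 / (1 - 2 powr (- (\<alpha> / 2) * enn2real R)) * A powr enn2real R)"
proof -
  let ?K = "1 / (1 - 2 powr (- (\<alpha> / 2) * enn2real R))"
  have "2 powr (- (\<alpha> / 2) * enn2real R) < 2 powr 0" using assms by (intro powr_less_mono) auto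
  then have K: "0 \<le> ?K" by simp
  have "(\<integral>\<^sup>+J. ennreal (discounted_sup \<alpha> a J powr enn2real R) \<partial>count_space UNIV) \<le>
      ennreal ?K * (\<integral>\<^sup>+j. ennreal (a j powr enn2real R) \<partial>count_space UNIV)"
    using assms by (intro sum_discounted_sup_powr_le[where A = A]) (auto simp: seq_norm_le_def)
  also have "\<dots> \<le> ennreal ?K * ennreal (A powr enn2real R)"
    using assms by (intro mult_left_mono) (auto simp: seq_norm_le_def)
  also have "\<dots> = ennreal (?K * A powr enn2real R)" using K by (intro ennreal_mult[symmetric]) auto
  finally show ?thesis .
qed

lemma tail_sum_le:
  assumes \<alpha>: "\<alpha> > 0" and a: "seq_norm_le R (\<lambda>j. 2 powr (of_int j * \<alpha>) * N j) A"
  shows "(\<integral>\<^sup>+j. ennreal (N j) \<partial>count_space {J..}) \<le>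
    ennreal (1 / (1 - 2 powr (- (\<alpha> / 2))) *
      (2 powr (- \<alpha> * of_int J) * discounted_sup \<alpha> (\<lambda>j. 2 powr (of_int j * \<alpha>) * N j) J))"
proof -
  have "2 powr (- \<alpha> * of_int j) * (2 powr (of_int j * \<alpha>) * N j) = N j" for j :: int
    by (simp add: mult.assoc[symmetric] powr_add[symmetric] mult.commute[of \<alpha>])
  then show ?thesis
    using tail_sum_le_discounted_sup[OF \<alpha>, of "\<lambda>j. 2 powr (of_int j * \<alpha>) * N j" A J] a
    by (simp only: seq_norm_le_def)
qed

lemma head_sum_le:
  assumes \<beta>: "\<beta> > 0" and b: "seq_norm_le R (\<lambda>j. 2 powr (of_int j * - \<beta>) * N j) B"
  shows "(\<integral>\<^sup>+j. ennreal (N j) \<partial>count_space {..J}) \<le>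
    ennreal (1 / (1 - 2 powr (- (\<beta> / 2))) *
      (2 powr (\<beta> * of_int J) * discounted_sup \<beta> (\<lambda>j. 2 powr (of_int j * \<beta>) * N (- j)) (- J)))"
proof -
  have bij: "bij_betw uminus {- J..} {..J}" by (rule bij_betwI[where g = uminus]) auto
  have "(\<integral>\<^sup>+j. ennreal (N j) \<partial>count_space {..J}) = (\<integral>\<^sup>+j. ennreal (N (- j)) \<partial>count_space {- J..})"
    by (rule nn_integral_bij_count_space[OF bij, symmetric])
  also have "\<dots> \<le> ennreal (1 / (1 - 2 powr (- (\<beta> / 2))) *
      (2 powr (- \<beta> * of_int (- J)) * discounted_sup \<beta> (\<lambda>j. 2 powr (of_int j * \<beta>) * N (- j)) (- J)))"
    using seq_norm_le_reflect[OF b] by (intro tail_sum_le[OF \<beta>, of R _ B]) simp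
  finally show ?thesis by simp
qed

text \<open>The index \<open>J\<close> is counted on both sides; this is harmless for an upper bound
  and keeps the two half-lines mirror images.\<close>

lemma nn_integral_count_space_split_le:
  fixes P Q :: "int \<Rightarrow> ennreal"
  shows "(\<integral>\<^sup>+j. (if J \<le> j then P j else Q j) \<partial>count_space UNIV) \<le>
    (\<integral>\<^sup>+j. P j \<partial>count_space {J..}) + (\<integral>\<^sup>+j. Q j \<partial>count_space {..J})"
proof -
  have "(\<integral>\<^sup>+j. (if J \<le> j then P j else Q j) \<partial>count_space UNIV) \<le>
      (\<integral>\<^sup>+j. P j * indicator {J..} j + Q j * indicator {..J} j \<partial>count_space UNIV)"
    by (rule nn_integral_mono) auto
  also have "\<dots> = (\<integral>\<^sup>+j. P j * indicator {J..} j \<partial>count_space UNIV) + (\<integral>\<^sup>+j. Q j * indicator {..J} j \<partial>count_space UNIV)"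
    by (rule nn_integral_add) auto
  finally show ?thesis by (simp add: nn_integral_count_space_indicator)
qed

lemma powr_mult_discounted_sup_tendsto_0:
  assumes \<alpha>: "\<alpha> > 0" and a: "\<And>j. 0 \<le> a j" "\<And>j. a j \<le> A"
  shows "((\<lambda>J::int. 2 powr (- \<alpha> * of_int J) * discounted_sup \<alpha> a J) \<longlongrightarrow> 0) at_top"
proof (rule Lim_null_comparison)
  show "\<forall>\<^sub>F J in at_top. norm (2 powr (- \<alpha> * of_int J) * discounted_sup \<alpha> a J) \<le> 2 powr (- \<alpha> * of_int J) * A"
    using discounted_sup_le[OF assms] discounted_sup_nonneg[OF assms]
    by (intro always_eventually allI) (simp add: mult_left_mono)
  have "filterlim (\<lambda>J::int. - (\<alpha> * ln 2) * of_int J) at_bot at_top"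
    using \<alpha> by (intro filterlim_tendsto_neg_mult_at_bot[OF tendsto_const] filterlim_real_of_int_at_top) simp
  from filterlim_compose[OF exp_at_bot this]
  have "((\<lambda>J::int. 2 powr (- \<alpha> * of_int J)) \<longlongrightarrow> 0) at_top"
    by (simp add: powr_def mult_ac)
  from tendsto_mult_left_zero[OF this] show "((\<lambda>J::int. 2 powr (- \<alpha> * of_int J) * A) \<longlongrightarrow> 0) at_top" .
qed

text \<open>The numerical core: \<open>i\<^sub>0\<close> and \<open>i\<^sub>1\<close> stand for the
  reciprocals of the Lebesgue exponents, \<open>N\<^sub>0\<close> and \<open>N\<^sub>1\<close> for
  the block norms. The rearrangement is bounded for every cut \<open>J\<close>, so the cut can be
  chosen separately for each \<open>s\<close>.\<close>

lemma interpolation_estimate: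
  fixes \<alpha> \<beta> \<theta> i\<^sub>0 i\<^sub>1 p :: real and r\<^sub>0 r\<^sub>1 r :: ennreal
  assumes \<alpha>: "\<alpha> > 0" and \<beta>: "\<beta> > 0" and \<theta>_eq: "\<theta> = \<alpha> / (\<alpha> + \<beta>)"
    and i: "i\<^sub>1 < i\<^sub>0" and p: "1 / p = (1 - \<theta>) * i\<^sub>0 + \<theta> * i\<^sub>1"
    and r0: "1 \<le> r\<^sub>0" "r\<^sub>0 \<le> r\<^sub>1" and r: "1 / r = ennreal (1 - \<theta>) / r\<^sub>0 + ennreal \<theta> / r\<^sub>1"
  obtains C where "C \<ge> 0"
    and "\<And>N\<^sub>0 N\<^sub>1 A B (g :: 'a::euclidean_space \<Rightarrow> complex).
      \<lbrakk>seq_norm_le r\<^sub>0 (\<lambda>j. 2 powr (of_int j * \<alpha>) * N\<^sub>0 j) A;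
       seq_norm_le r\<^sub>1 (\<lambda>j. 2 powr (of_int j * - \<beta>) * N\<^sub>1 j) B;
       \<And>s J. s > 0 \<Longrightarrow> decr_rearrangement g s \<le> (\<integral>\<^sup>+j. ennreal (2 *
         (s powr - (if J \<le> j then i\<^sub>0 else i\<^sub>1) * (if J \<le> j then N\<^sub>0 j else N\<^sub>1 j))) \<partial>count_space UNIV)\<rbrakk>
      \<Longrightarrow> lorentz_norm p r g \<le> ennreal (C * (A powr (1 - \<theta>) * B powr \<theta>))"
proof -
  define \<delta> where "\<delta> = i\<^sub>0 - i\<^sub>1"
  have \<delta>: "\<delta> > 0" using i by (simp add: \<delta>_def)
  have \<theta>: "0 < \<theta>" "\<theta> < 1" using \<alpha> \<beta> by (simp_all add: \<theta>_eq)
  \<comment> \<open>This choice of \<open>\<theta>\<close> cancels the powers of 2 depending on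
    \<open>J\<close> in \<open>FG_eq\<close> below.\<close>
  have \<alpha>\<beta>: "\<alpha> * (1 - \<theta>) = \<beta> * \<theta>" using \<alpha> \<beta> by (simp add: \<theta>_eq field_simps)
  have r1: "1 \<le> r\<^sub>1" using r0 by (rule order_trans)
  define \<rho> where "\<rho> = enn2real (1 / r\<^sub>1)"
  have \<rho>: "\<rho> = (if r\<^sub>1 = \<infinity> then 0 else 1 / enn2real r\<^sub>1)"
    unfolding \<rho>_def by (rule enn2real_recip[OF r1])
  have fin: "r < \<infinity> \<and> enn2real r > 0 \<and> enn2real r\<^sub>0 > 0 \<and> 1 / enn2real r = (1 - \<theta>) / enn2real r\<^sub>0 + \<theta> * \<rho>"
    if "r\<^sub>0 < \<infinity>"
    using real_exponent[OF r0(1) that r1 \<theta> r] enn2real_recip[OF r0(1)] that r0(1)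
    by (cases r\<^sub>0) (auto simp: \<rho>_def simp flip: ennreal_1)
  have inf: "r = \<infinity>" if "r\<^sub>0 = \<infinity>"
  proof -
    have "r\<^sub>1 = \<infinity>" using that r0 by (simp add: top_unique)
    then have "1 / r = 0" using that r by simp
    then show ?thesis by (simp add: ennreal_divide_zero)
  qed
  define K\<^sub>a where "K\<^sub>a = 1 / (1 - 2 powr (- (\<alpha> / 2)))"
  define K\<^sub>b where "K\<^sub>b = 1 / (1 - 2 powr (- (\<beta> / 2)))"
  have small: "2 powr (- x) < (1::real)" if "x > 0" for x
    using powr_less_mono[of "- x" 0 2] that by simp
  have K: "K\<^sub>a > 0" "K\<^sub>b > 0" using small[of "\<alpha> / 2"] small[of "\<beta> / 2"] \<alpha> \<beta> by (auto simp: K\<^sub>a_def K\<^sub>b_def)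
  define K where "K = 2 * max K\<^sub>a K\<^sub>b"
  have K_pos: "K > 0" using K by (simp add: K_def)
  define L\<^sub>0 where "L\<^sub>0 = 1 / (1 - 2 powr (- (\<alpha> / 2) * enn2real r\<^sub>0))"
  define L\<^sub>1 where "L\<^sub>1 = (if r\<^sub>1 = \<infinity> then 0 else 1 / (1 - 2 powr (- (\<beta> / 2) * enn2real r\<^sub>1)))"
  \<comment> \<open>The factor \<open>2 powr (\<beta> * \<theta>)\<close> is the price of the shift
    from \<open>J\<close> to \<open>J + 1\<close> in \<open>G\<close>; \<open>L\<^sub>0\<close> and
    \<open>L\<^sub>1\<close> are the constants of the summed suprema.\<close>
  define L where "L = 2 powr (\<beta> * \<theta>) * (if r = \<infinity> then 1 else (L\<^sub>0 + L\<^sub>1) powr (1 / enn2real r))"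
  have L: "L \<ge> 0" by (simp add: L_def)
  define c where "c = (if r = \<infinity> then 1 else
      (1 / (\<theta> * \<delta> * enn2real r) + 1 / ((1 - \<theta>) * \<delta> * enn2real r)) powr (1 / enn2real r))"
  have c: "c \<ge> 0" by (simp add: c_def)
  show ?thesis
  proof (rule that[of "2 * K * c * L"])
    show "0 \<le> 2 * K * c * L" using K_pos c L by simp
  next
    fix N\<^sub>0 N\<^sub>1 A B and g :: "'a \<Rightarrow> complex"
    define a where "a j = 2 powr (of_int j * \<alpha>) * N\<^sub>0 j" for j :: int
    define b where "b j = 2 powr (of_int j * \<beta>) * N\<^sub>1 (- j)" for j :: int
    assume a': "seq_norm_le r\<^sub>0 (\<lambda>j. 2 powr (of_int j * \<alpha>) * N\<^sub>0 j) A"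
      and b': "seq_norm_le r\<^sub>1 (\<lambda>j. 2 powr (of_int j * - \<beta>) * N\<^sub>1 j) B"
      and g: "\<And>s J. s > 0 \<Longrightarrow> decr_rearrangement g s \<le> (\<integral>\<^sup>+j. ennreal (2 *
         (s powr - (if J \<le> j then i\<^sub>0 else i\<^sub>1) * (if J \<le> j then N\<^sub>0 j else N\<^sub>1 j))) \<partial>count_space UNIV)"
    have a: "seq_norm_le r\<^sub>0 a A" using a' by (simp add: a_def[abs_def])
    have b: "seq_norm_le r\<^sub>1 b B" using seq_norm_le_reflect[OF b'] by (simp add: b_def[abs_def])
    have a_bd: "0 \<le> a j" "a j \<le> A" and b_bd: "0 \<le> b j" "b j \<le> B" for j
      using a b by (auto simp: seq_norm_le_def)
    define x where "x J = discounted_sup \<alpha> a J" for J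
    \<comment> \<open>Since \<open>b\<close> is reflected, the argument \<open>- J\<close> makes
      this a supremum over the original indices up to \<open>J\<close>.\<close>
    define y where "y J = discounted_sup \<beta> b (- J)" for J
    have x: "0 \<le> x J" "x J \<le> A" and y: "0 \<le> y J" "y J \<le> B" for J
      unfolding x_def y_def
      using discounted_sup_nonneg[OF \<alpha> a_bd] discounted_sup_le[OF \<alpha> a_bd]
        discounted_sup_nonneg[OF \<beta> b_bd] discounted_sup_le[OF \<beta> b_bd] by auto
    define F where "F J = 2 powr (- \<alpha> * of_int J) * x J" for J :: int
    define G where "G J = 2 powr (\<beta> * of_int J) * y J" for J :: int
    have FG: "0 \<le> F J" "0 \<le> G J" for J using x y by (simp_all add: F_def G_def)
    have F_lim: "(F \<longlongrightarrow> 0) at_top"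
      unfolding F_def[abs_def] x_def by (rule powr_mult_discounted_sup_tendsto_0[OF \<alpha> a_bd])
    have G_lim: "(G \<longlongrightarrow> 0) at_bot"
      using powr_mult_discounted_sup_tendsto_0[OF \<beta> b_bd]
      by (simp add: at_bot_mirror filterlim_filtermap G_def y_def)
    have decr: "decr_rearrangement g s \<le> ennreal (K * (s powr - i\<^sub>0 * F J + s powr - i\<^sub>1 * G J))" if s: "s > 0" for s J
    proof -
      have "decr_rearrangement g s \<le> (\<integral>\<^sup>+j. (if J \<le> j then ennreal (2 * s powr - i\<^sub>0) * ennreal (N\<^sub>0 j)
          else ennreal (2 * s powr - i\<^sub>1) * ennreal (N\<^sub>1 j)) \<partial>count_space UNIV)"
        using g[OF s, of J] by (rule order_trans) (auto intro!: nn_integral_mono simp: ennreal_mult' mult.assoc)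
      also have "\<dots> \<le> ennreal (2 * s powr - i\<^sub>0) * (\<integral>\<^sup>+j. ennreal (N\<^sub>0 j) \<partial>count_space {J..}) +
          ennreal (2 * s powr - i\<^sub>1) * (\<integral>\<^sup>+j. ennreal (N\<^sub>1 j) \<partial>count_space {..J})"
        by (rule order_trans[OF nn_integral_count_space_split_le]) (simp add: nn_integral_cmult)
      also have "\<dots> \<le> ennreal (2 * s powr - i\<^sub>0) * ennreal (K\<^sub>a * F J) + ennreal (2 * s powr - i\<^sub>1) * ennreal (K\<^sub>b * G J)"
        using tail_sum_le[OF \<alpha> a', of J] head_sum_le[OF \<beta> b', of J]
        by (intro add_mono mult_left_mono)
           (simp_all add: K\<^sub>a_def K\<^sub>b_def F_def G_def x_def y_def a_def[abs_def] b_def[abs_def])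
      also have "\<dots> = ennreal (2 * s powr - i\<^sub>0 * (K\<^sub>a * F J) + 2 * s powr - i\<^sub>1 * (K\<^sub>b * G J))"
        using K FG[of J] by (simp add: ennreal_mult[symmetric] ennreal_plus[symmetric] del: ennreal_plus)
      also have "\<dots> \<le> ennreal (K * (s powr - i\<^sub>0 * F J + s powr - i\<^sub>1 * G J))"
      proof (rule ennreal_leI)
        have "K\<^sub>a * (s powr - i\<^sub>0 * F J) \<le> max K\<^sub>a K\<^sub>b * (s powr - i\<^sub>0 * F J)"
          "K\<^sub>b * (s powr - i\<^sub>1 * G J) \<le> max K\<^sub>a K\<^sub>b * (s powr - i\<^sub>1 * G J)"
          using FG[of J] by (auto intro!: mult_right_mono)
        then show "2 * s powr - i\<^sub>0 * (K\<^sub>a * F J) + 2 * s powr - i\<^sub>1 * (K\<^sub>b * G J) \<le>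
            K * (s powr - i\<^sub>0 * F J + s powr - i\<^sub>1 * G J)"
          by (simp add: K_def algebra_simps)
      qed
      finally show ?thesis .
    qed
    have cross: "\<exists>J. ennreal (s powr (1 / p)) * decr_rearrangement g s \<le>
        ennreal (2 * K * min (s powr - (\<theta> * \<delta>) * F J) (s powr ((1 - \<theta>) * \<delta>) * G (J + 1)))" if s: "s > 0" for s
    proof -
      obtain H where H: "decr_rearrangement g s = ennreal H" "H \<ge> 0"
        using decr[OF s, of 0] by (cases "decr_rearrangement g s") (auto simp: top_unique)
      have "H \<le> K * s powr - i\<^sub>0 * F J + K * s powr - i\<^sub>1 * G J" for J
      proof -
        have "0 \<le> K * (s powr - i\<^sub>0 * F J + s powr - i\<^sub>1 * G J)"
          using K_pos FG[of J] by simp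
        then have "H \<le> K * (s powr - i\<^sub>0 * F J + s powr - i\<^sub>1 * G J)"
          using decr[OF s, of J] unfolding H(1) by (rule ennreal_le_iff[THEN iffD1])
        then show ?thesis by (simp add: algebra_simps)
      qed
      moreover have "((\<lambda>J. K * s powr - i\<^sub>0 * F J) \<longlongrightarrow> 0) at_top" "((\<lambda>J. K * s powr - i\<^sub>1 * G J) \<longlongrightarrow> 0) at_bot"
        using tendsto_mult_right_zero[OF F_lim] tendsto_mult_right_zero[OF G_lim] by auto
      ultimately have "H \<le> 0 \<or> (\<exists>J. H \<le> 2 * (K * s powr - i\<^sub>0 * F J) \<and> H \<le> 2 * (K * s powr - i\<^sub>1 * G (J + 1)))"
        by (rule exists_crossing)
      \<comment> \<open>If \<open>H \<le> 0\<close>, every \<open>J\<close> will do, since both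
        bounds are non-negative.\<close>
      moreover have "0 \<le> 2 * (K * s powr - i\<^sub>0 * F J)" "0 \<le> 2 * (K * s powr - i\<^sub>1 * G J)" for J
        using K_pos FG[of J] by simp_all
      ultimately obtain J where J: "H \<le> 2 * (K * s powr - i\<^sub>0 * F J)" "H \<le> 2 * (K * s powr - i\<^sub>1 * G (J + 1))"
        by (meson order_trans)
      \<comment> \<open>Multiplication by \<open>s powr (1 / p)\<close> turns the two exponents of
        \<open>s\<close> into exponents of opposite sign.\<close>
      have e: "1 / p - i\<^sub>0 = - (\<theta> * \<delta>)" "1 / p - i\<^sub>1 = (1 - \<theta>) * \<delta>"
        using p by (simp_all add: \<delta>_def algebra_simps)
      have "s powr (1 / p) * H \<le> s powr (1 / p) * (2 * (K * s powr - i\<^sub>0 * F J))"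
        "s powr (1 / p) * H \<le> s powr (1 / p) * (2 * (K * s powr - i\<^sub>1 * G (J + 1)))"
        using J by (auto intro: mult_left_mono)
      moreover have "s powr (1 / p) * (2 * (K * s powr - i\<^sub>0 * F J)) = 2 * K * (s powr - (\<theta> * \<delta>) * F J)"
        "s powr (1 / p) * (2 * (K * s powr - i\<^sub>1 * G (J + 1))) = 2 * K * (s powr ((1 - \<theta>) * \<delta>) * G (J + 1))"
        unfolding e[symmetric] by (simp_all add: powr_diff powr_minus divide_inverse)
      ultimately have "s powr (1 / p) * H \<le> 2 * K * min (s powr - (\<theta> * \<delta>) * F J) (s powr ((1 - \<theta>) * \<delta>) * G (J + 1))"
        by (simp add: min_def)
      then show ?thesis using H by (intro exI[of _ J]) (simp add: ennreal_mult[symmetric] ennreal_leI)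
    qed
    have FG_eq: "F J powr (1 - \<theta>) * G (J + 1) powr \<theta> = 2 powr (\<beta> * \<theta>) * (x J powr (1 - \<theta>) * y (J + 1) powr \<theta>)" for J
    proof -
      have "F J powr (1 - \<theta>) * G (J + 1) powr \<theta> =
          2 powr (- \<alpha> * of_int J * (1 - \<theta>)) * 2 powr (\<beta> * of_int (J + 1) * \<theta>) * (x J powr (1 - \<theta>) * y (J + 1) powr \<theta>)"
        using x[of J] y[of "J + 1"] by (simp add: F_def G_def powr_mult powr_powr)
      also have "2 powr (- \<alpha> * of_int J * (1 - \<theta>)) * 2 powr (\<beta> * of_int (J + 1) * \<theta>) =
          2 powr (- \<alpha> * of_int J * (1 - \<theta>) + \<beta> * of_int (J + 1) * \<theta>)"
        by (rule powr_add[symmetric])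
      also have "- \<alpha> * of_int J * (1 - \<theta>) + \<beta> * of_int (J + 1) * \<theta> = \<beta> * \<theta> + of_int J * (\<beta> * \<theta> - \<alpha> * (1 - \<theta>))"
        by (simp add: algebra_simps)
      also have "\<dots> = \<beta> * \<theta>" by (simp add: \<alpha>\<beta>)
      finally show ?thesis .
    qed
    have M: "if r = \<infinity> then \<forall>J. F J powr (1 - \<theta>) * G (J + 1) powr \<theta> \<le> L * (A powr (1 - \<theta>) * B powr \<theta>)
      else enn2real r > 0 \<and> (\<integral>\<^sup>+J. ennreal ((F J powr (1 - \<theta>) * G (J + 1) powr \<theta>) powr enn2real r) \<partial>count_space UNIV)
        \<le> ennreal ((L * (A powr (1 - \<theta>) * B powr \<theta>)) powr enn2real r)"
    proof (cases "r = \<infinity>")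
      case True
      have "x J powr (1 - \<theta>) * y (J + 1) powr \<theta> \<le> A powr (1 - \<theta>) * B powr \<theta>" for J
        using x y \<theta> by (intro mult_mono powr_mono2) auto
      then show ?thesis using True by (simp add: FG_eq L_def)
    next
      case False
      then have "r\<^sub>0 \<noteq> \<infinity>" using inf by blast
      then have "r\<^sub>0 < \<infinity>" by (simp add: less_top)
      note R = fin[OF this]
      define R where "R = enn2real r"
      have R_pos: "R > 0" using R by (simp add: R_def)
      have L0: "L\<^sub>0 \<ge> 0" using small[of "\<alpha> / 2 * enn2real r\<^sub>0"] \<alpha> R by (simp add: L\<^sub>0_def)
      have r1_pos: "enn2real r\<^sub>1 > 0" if "r\<^sub>1 \<noteq> \<infinity>"
        using r1 that by (cases r\<^sub>1) (auto simp flip: ennreal_1)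
      have L1: "L\<^sub>1 \<ge> 0"
        using small[of "\<beta> / 2 * enn2real r\<^sub>1"] \<beta> r1_pos by (auto simp: L\<^sub>1_def)
      \<comment> \<open>Reindexing for \<open>y (J + 1)\<close>, which is
        \<open>discounted_sup\<close> of \<open>b\<close> at \<open>- (J + 1)\<close>.\<close>
      have bij: "bij (\<lambda>J::int. - (J + 1))" by (rule bij_betwI[where g = "\<lambda>J. - J - 1"]) auto
      have sum: "(\<integral>\<^sup>+J. ennreal ((x J powr (1 - \<theta>) * y (J + 1) powr \<theta>) powr R) \<partial>count_space UNIV) \<le>
          ennreal ((L\<^sub>0 + L\<^sub>1) * (A powr (1 - \<theta>) * B powr \<theta>) powr R)"
      proof (rule sum_interpolated_powr_le[where R\<^sub>0 = "enn2real r\<^sub>0" and \<rho> = \<rho>, OF \<theta> R_pos _ _ _ x y L0 L1])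
        show "0 < enn2real r\<^sub>0" "1 / R = (1 - \<theta>) / enn2real r\<^sub>0 + \<theta> * \<rho>" using R by (auto simp: R_def)
        show "0 \<le> \<rho>" by (simp add: \<rho>_def)
        show "(\<integral>\<^sup>+J. ennreal (x J powr enn2real r\<^sub>0) \<partial>count_space UNIV) \<le> ennreal (L\<^sub>0 * A powr enn2real r\<^sub>0)"
          unfolding x_def L\<^sub>0_def using \<open>r\<^sub>0 < \<infinity>\<close> R by (intro sum_discounted_sup_le_seq_norm \<alpha> a) auto
        assume "\<rho> > 0"
        then have r1': "r\<^sub>1 \<noteq> \<infinity>" "1 / \<rho> = enn2real r\<^sub>1" by (auto simp: \<rho> split: if_splits)
        have "(\<integral>\<^sup>+J. ennreal (y (J + 1) powr enn2real r\<^sub>1) \<partial>count_space UNIV) =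
            (\<integral>\<^sup>+J. ennreal (discounted_sup \<beta> b J powr enn2real r\<^sub>1) \<partial>count_space UNIV)"
          unfolding y_def by (rule nn_integral_bij_count_space[OF bij])
        also have "\<dots> \<le> ennreal (L\<^sub>1 * B powr enn2real r\<^sub>1)"
          using sum_discounted_sup_le_seq_norm[OF \<beta> b _ r1_pos] r1' by (simp add: L\<^sub>1_def top.not_eq_extremum)
        finally show "(\<integral>\<^sup>+J. ennreal (y (J + 1) powr (1 / \<rho>)) \<partial>count_space UNIV) \<le> ennreal (L\<^sub>1 * B powr (1 / \<rho>))"
          unfolding r1'(2) .
      qed
      have "(\<integral>\<^sup>+J. ennreal ((F J powr (1 - \<theta>) * G (J + 1) powr \<theta>) powr R) \<partial>count_space UNIV) =
          (\<integral>\<^sup>+J. ennreal ((2 powr (\<beta> * \<theta>)) powr R) * ennreal ((x J powr (1 - \<theta>) * y (J + 1) powr \<theta>) powr R) \<partial>count_space UNIV)"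
        by (simp add: FG_eq powr_mult ennreal_mult)
      also have "\<dots> = ennreal ((2 powr (\<beta> * \<theta>)) powr R) * (\<integral>\<^sup>+J. ennreal ((x J powr (1 - \<theta>) * y (J + 1) powr \<theta>) powr R) \<partial>count_space UNIV)"
        by (rule nn_integral_cmult) simp
      also have "\<dots> \<le> ennreal ((2 powr (\<beta> * \<theta>)) powr R) * ennreal ((L\<^sub>0 + L\<^sub>1) * (A powr (1 - \<theta>) * B powr \<theta>) powr R)"
        by (intro mult_left_mono sum) simp
      also have "\<dots> = ennreal ((L * (A powr (1 - \<theta>) * B powr \<theta>)) powr R)"
        using False R_pos L0 L1 by (simp add: L_def R_def[symmetric] powr_mult powr_powr ennreal_mult[symmetric] mult_ac)
      finally show ?thesis using False R_pos by (simp add: R_def)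
    qed
    have "lorentz_norm p r g \<le> ennreal (2 * K * c * (L * (A powr (1 - \<theta>) * B powr \<theta>)))"
      unfolding c_def
      by (rule lorentz_norm_le[OF \<theta> \<delta> _ FG(1) FG(2) cross _ M]) (use K_pos L in auto)
    then show "lorentz_norm p r g \<le> ennreal (2 * K * c * L * (A powr (1 - \<theta>) * B powr \<theta>))"
      by (simp add: mult.assoc)
  qed
qed

theorem theorem4:
  fixes \<phi> :: "real ^ 'n \<Rightarrow> real"
    and \<alpha> \<beta> \<theta> p :: real
    and q\<^sub>0 q\<^sub>1 r\<^sub>0 r\<^sub>1 r :: ennreal
  assumes "lp_cutoff \<phi>"
    and "\<alpha> > 0" and "\<beta> > 0"
    and "1 \<le> q\<^sub>0" and "q\<^sub>0 < q\<^sub>1"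
    and "\<theta> = \<alpha> / (\<alpha> + \<beta>)"
    and "1 / ennreal p = ennreal (1 - \<theta>) / q\<^sub>0 + ennreal \<theta> / q\<^sub>1"
    and "q\<^sub>0 \<le> r\<^sub>0" and "r\<^sub>0 \<le> r\<^sub>1" and "r\<^sub>1 \<le> q\<^sub>1"
    and "1 / r = ennreal (1 - \<theta>) / r\<^sub>0 + ennreal \<theta> / r\<^sub>1"
  shows "\<exists>C\<^sub>0\<ge>0. \<forall>f :: (real ^ 'n \<Rightarrow> complex) \<Rightarrow> complex.
           tempered_distribution f \<longrightarrow> lp_sum_converges \<phi> f \<longrightarrow>
           besov_seminorm \<phi> \<alpha> q\<^sub>0 r\<^sub>0 f < \<infinity> \<longrightarrow> besov_seminorm \<phi> (- \<beta>) q\<^sub>1 r\<^sub>1 f < \<infinity> \<longrightarrow>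
           (\<exists>g. represents g f \<and> g \<in> lorentz_space p r \<and>
                lorentz_norm p r g \<le> ennreal C\<^sub>0 *
                  besov_seminorm \<phi> \<alpha> q\<^sub>0 r\<^sub>0 f epowr (1 - \<theta>) *
                  besov_seminorm \<phi> (- \<beta>) q\<^sub>1 r\<^sub>1 f epowr \<theta>)"
proof -
  note \<phi> = assms(1) and \<alpha> = assms(2) and \<beta> = assms(3)
  define i\<^sub>0 where "i\<^sub>0 = enn2real (1 / q\<^sub>0)"
  define i\<^sub>1 where "i\<^sub>1 = enn2real (1 / q\<^sub>1)"
  have \<theta>: "0 < \<theta>" "\<theta> < 1" using \<alpha> \<beta> by (simp_all add: assms(6))
  have q: "q\<^sub>0 < \<infinity>" "1 \<le> q\<^sub>1" using assms(4,5) by (auto intro: less_le_trans order_trans less_imp_le)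
  have r0: "1 \<le> r\<^sub>0" and r1: "1 \<le> r\<^sub>1" using assms(4,8,9) by (auto intro: order_trans)
  have i: "i\<^sub>1 < i\<^sub>0" unfolding i\<^sub>0_def i\<^sub>1_def by (rule enn2real_recip_less[OF assms(4,5)])
  have "enn2real (ennreal p) > 0" "1 / enn2real (ennreal p) = (1 - \<theta>) * i\<^sub>0 + \<theta> * i\<^sub>1"
    using real_exponent[OF assms(4) q \<theta> assms(7)] by (auto simp: i\<^sub>0_def i\<^sub>1_def)
  \<comment> \<open>A negative \<open>p\<close> would make \<open>ennreal p\<close> zero, against
    the positivity just obtained.\<close>
  then have p: "1 / p = (1 - \<theta>) * i\<^sub>0 + \<theta> * i\<^sub>1" by (cases "p \<ge> 0") (auto simp: ennreal_neg)
  obtain C where C: "C \<ge> 0"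
    and est: "\<And>N\<^sub>0 N\<^sub>1 A B (g :: real ^ 'n \<Rightarrow> complex).
      \<lbrakk>seq_norm_le r\<^sub>0 (\<lambda>j. 2 powr (of_int j * \<alpha>) * N\<^sub>0 j) A;
       seq_norm_le r\<^sub>1 (\<lambda>j. 2 powr (of_int j * - \<beta>) * N\<^sub>1 j) B;
       \<And>s J. s > 0 \<Longrightarrow> decr_rearrangement g s \<le> (\<integral>\<^sup>+j. ennreal (2 *
         (s powr - (if J \<le> j then i\<^sub>0 else i\<^sub>1) * (if J \<le> j then N\<^sub>0 j else N\<^sub>1 j))) \<partial>count_space UNIV)\<rbrakk>
      \<Longrightarrow> lorentz_norm p r g \<le> ennreal (C * (A powr (1 - \<theta>) * B powr \<theta>))"
    by (rule interpolation_estimate[OF \<alpha> \<beta> assms(6) i p r0 assms(9,11), where 'a = "real ^ 'n"]) blast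
  show ?thesis
  proof (intro exI[of _ C] conjI allI impI C)
    fix f :: "(real ^ 'n \<Rightarrow> complex) \<Rightarrow> complex"
    assume conv: "lp_sum_converges \<phi> f"
      and fin0: "besov_seminorm \<phi> \<alpha> q\<^sub>0 r\<^sub>0 f < \<infinity>" and fin1: "besov_seminorm \<phi> (- \<beta>) q\<^sub>1 r\<^sub>1 f < \<infinity>"
    define A where "A = enn2real (besov_seminorm \<phi> \<alpha> q\<^sub>0 r\<^sub>0 f)"
    define B where "B = enn2real (besov_seminorm \<phi> (- \<beta>) q\<^sub>1 r\<^sub>1 f)"
    obtain N\<^sub>0 where N0: "\<And>j. 0 \<le> N\<^sub>0 j" "\<And>j. lebesgue_norm_dist q\<^sub>0 (dyadic_block \<phi> j f) = ennreal (N\<^sub>0 j)"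
      "seq_norm_le r\<^sub>0 (\<lambda>j. 2 powr (of_int j * \<alpha>) * N\<^sub>0 j) A"
      using besov_seminorm_finite[OF r0 fin0] unfolding A_def by blast
    obtain N\<^sub>1 where N1: "\<And>j. 0 \<le> N\<^sub>1 j" "\<And>j. lebesgue_norm_dist q\<^sub>1 (dyadic_block \<phi> j f) = ennreal (N\<^sub>1 j)"
      "seq_norm_le r\<^sub>1 (\<lambda>j. 2 powr (of_int j * - \<beta>) * N\<^sub>1 j) B"
      using besov_seminorm_finite[OF r1 fin1] unfolding B_def by blast
    \<comment> \<open>Without a representing function the infimum in the norm would be over the
      empty set, hence infinite.\<close>
    have "\<exists>u. represents u (dyadic_block \<phi> j f)" for j
    proof (rule ccontr)
      assume "\<nexists>u. represents u (dyadic_block \<phi> j f)"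
      then have "lebesgue_norm_dist q\<^sub>0 (dyadic_block \<phi> j f) = top"
        by (simp add: lebesgue_norm_dist_def)
      then show False using N0(2)[of j] by simp
    qed
    then obtain u where u: "\<And>j. represents (u j) (dyadic_block \<phi> j f)" by metis
    \<comment> \<open>High frequencies are measured with \<open>q\<^sub>0\<close>, low ones with
      \<open>q\<^sub>1\<close>.\<close>
    define Q where "Q J j = (if J \<le> j then q\<^sub>0 else q\<^sub>1)" for J j :: int
    define N where "N J j = (if J \<le> j then N\<^sub>0 j else N\<^sub>1 j)" for J j :: int
    have Q: "1 \<le> Q J j" for J j using assms(4) q(2) by (simp add: Q_def)
    have N: "0 \<le> N J j" "lebesgue_norm (Q J j) (u j) \<le> ennreal (N J j)" for J j
      using N0(1,2)[of j] N1(1,2)[of j] lebesgue_norm_dist_eq[OF \<phi> u[of j]] by (simp_all add: N_def Q_def)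
    \<comment> \<open>With the cut at 0 the Besov weights force geometric decay of the chosen norms
      in both directions.\<close>
    have "(\<integral>\<^sup>+j. ennreal (N 0 j) \<partial>count_space UNIV) \<le>
        (\<integral>\<^sup>+j. ennreal (N\<^sub>0 j) \<partial>count_space {0..}) + (\<integral>\<^sup>+j. ennreal (N\<^sub>1 j) \<partial>count_space {..0})"
      using nn_integral_count_space_split_le[of 0 "\<lambda>j. ennreal (N\<^sub>0 j)" "\<lambda>j. ennreal (N\<^sub>1 j)"]
      by (simp add: N_def if_distrib cong: if_cong)
    also have "\<dots> < \<infinity>"
      using le_less_trans[OF tail_sum_le[OF \<alpha> N0(3), of 0] ennreal_less_top]
        le_less_trans[OF head_sum_le[OF \<beta> N1(3), of 0] ennreal_less_top] by simp
    finally have sum_fin: "(\<integral>\<^sup>+j. ennreal (N 0 j) \<partial>count_space UNIV) < \<infinity>" .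
    obtain g where g: "represents g f"
      "AE x in lborel. ennreal (norm (g x)) \<le> (\<integral>\<^sup>+j. ennreal (norm (u j x)) \<partial>count_space UNIV)"
      by (rule lp_sum_representation[OF conv u Q[of 0] N(1)[of 0] N(2)[of 0] sum_fin])
    have g_meas: "g \<in> borel_measurable borel" and u_meas: "u j \<in> borel_measurable borel" for j
      using g(1) u[of j] by (simp_all add: represents_def)
    have bound: "lorentz_norm p r g \<le> ennreal (C * (A powr (1 - \<theta>) * B powr \<theta>))"
    proof (rule est[OF N0(3) N1(3)])
      fix s :: real and J :: int assume s: "s > 0"
      have e: "(if J \<le> j then i\<^sub>0 else i\<^sub>1) = enn2real (1 / Q J j)" for j
        by (simp add: Q_def i\<^sub>0_def i\<^sub>1_def)
      \<comment> \<open>Though \<open>g\<close> was obtained from the cut at 0, its pointwise bound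
        does not involve the cut, so the rearrangement estimate holds for every
        \<open>J\<close>.\<close>
      from decr_rearrangement_le[of u g "Q J" "N J" s, OF u_meas g_meas g(2) Q N s]
      show "decr_rearrangement g s \<le> (\<integral>\<^sup>+j. ennreal (2 *
         (s powr - (if J \<le> j then i\<^sub>0 else i\<^sub>1) * (if J \<le> j then N\<^sub>0 j else N\<^sub>1 j))) \<partial>count_space UNIV)"
        unfolding e N_def[symmetric] .
    qed
    have AB: "besov_seminorm \<phi> \<alpha> q\<^sub>0 r\<^sub>0 f = ennreal A" "besov_seminorm \<phi> (- \<beta>) q\<^sub>1 r\<^sub>1 f = ennreal B"
      using fin0 fin1 by (simp_all add: A_def B_def ennreal_enn2real_if)
    have "ennreal (C * (A powr (1 - \<theta>) * B powr \<theta>)) = ennreal C *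
        besov_seminorm \<phi> \<alpha> q\<^sub>0 r\<^sub>0 f epowr (1 - \<theta>) * besov_seminorm \<phi> (- \<beta>) q\<^sub>1 r\<^sub>1 f epowr \<theta>"
      unfolding AB using C by (simp add: A_def B_def epowr_ennreal ennreal_mult mult.assoc)
    moreover have "lorentz_norm p r g < \<infinity>" using bound by (simp add: le_less_trans)
    then have "g \<in> lorentz_space p r" using g_meas by (simp add: lorentz_space_def)
    ultimately show "\<exists>g. represents g f \<and> g \<in> lorentz_space p r \<and>
        lorentz_norm p r g \<le> ennreal C * besov_seminorm \<phi> \<alpha> q\<^sub>0 r\<^sub>0 f epowr (1 - \<theta>) *
          besov_seminorm \<phi> (- \<beta>) q\<^sub>1 r\<^sub>1 f epowr \<theta>"
      using g(1) bound by (intro exI[of _ g]) simp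
  qed
qed

end
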